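(* Let $G\subset\mathbb{R}^n$ be open, let $\mu$ be a Borel probability measure on $G$ satisfying a logarithmic Sobolev inequality with constant $\sigma^2>0$, let $d\in\mathbb{N}$, $d\ge 1$, and let $f:G\to\mathbb{R}$ be a $\mathcal{C}^d$-smooth function such that $\int_G f\,d\mu=0$. For $t\ge0$ put $$\eta_f(t)=\min\Big(\frac{t^{2/d}}{\sigma^2\lVert f^{(d)}\rVert_{\mathrm{Op},\infty}^{2/d}},\ \min_{k=1,\dots,d-1}\frac{t^{2/k}}{\sigma^2\lVert f^{(k)}\rVert_{\mathrm{Op},2}^{2/k}}\Big).$$ Then, for any $t\ge 0$, $$\mu(|f|\ge t)\le e^2\exp\Big\{-\frac{\eta_f(t)}{(de)^2}\Big\}.$$
   Context: $\mu$ satisfies a logarithmic Sobolev inequality with constant $\sigma^2$ if $\mathrm{Ent}_\mu(g^2)\le 2\sigma^2\int|\nabla g|^2\,d\mu$ for every bounded smooth function $g$ on $G$, where $\mathrm{Ent}_\mu(g^2)=\int g^2\log g^2\,d\mu-\int g^2\,d\mu\,\log\int g^2\,d\mu$. $f^{(k)}(x)$ is the hypermatrix of $k$-th order partial derivatives $\partial_{i_1\dots i_k}f(x)$, viewed as a symmetric $k$-linear form, with $|f^{(k)}(x)|_{\mathrm{Op}}=\sup\{f^{(k)}(x)[v_1,\dots,v_k]:|v_1|=\dots=|v_k|=1\}$; $\lVert f^{(k)}\rVert_{\mathrm{Op},p}$ is the $L^p(\mu)$-norm of $|f^{(k)}|_{\mathrm{Op}}$, $p\in(0,\infty]$. A minimum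 over an empty set (case $d=1$) is $+\infty$; a quotient with zero denominator is read as $+\infty$ for $t>0$ and as $0$ for $t=0$, a quotient with infinite denominator is $0$; $\exp(-\infty)=0$. *)

theory Defs
  imports "HOL-Probability.Probability"
begin

definition partial_deriv :: "'n \<Rightarrow> (real^'n::finite \<Rightarrow> real) \<Rightarrow> real^'n \<Rightarrow> real" where
  "partial_deriv i f x = deriv (\<lambda>h. f (x + h *\<^sub>R axis i 1)) 0"

primrec iterated_partial :: "'n list \<Rightarrow> (real^'n::finite \<Rightarrow> real) \<Rightarrow> real^'n \<Rightarrow> real" where
  "iterated_partial [] f = f"
| "iterated_partial (i # is) f = partial_deriv i (iterated_partial is f)"

(* Functions on G are total functions whose values outside G play no role:
   all these notions are only used on open sets G. *)
primrec C_on :: "nat \<Rightarrow> (real^'n::finite) set \<Rightarrow> (real^'n \<Rightarrow> real) \<Rightarrow> bool" where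
  "C_on 0 G f \<longleftrightarrow> continuous_on G f"
| "C_on (Suc k) G f \<longleftrightarrow>
     (\<forall>x\<in>G. f differentiable (at x)) \<and> (\<forall>i. C_on k G (partial_deriv i f))"

definition smooth_on :: "(real^'n::finite) set \<Rightarrow> (real^'n \<Rightarrow> real) \<Rightarrow> bool" where
  "smooth_on G f \<longleftrightarrow> (\<forall>k. C_on k G f)"

definition grad :: "(real^'n::finite \<Rightarrow> real) \<Rightarrow> real^'n \<Rightarrow> real^'n" where
  "grad f x = (\<chi> i. partial_deriv i f x)"

(* The convention 0 log 0 = 0 holds because ln 0 = 0. *)
definition Ent :: "'a measure \<Rightarrow> ('a \<Rightarrow> real) \<Rightarrow> real" where
  "Ent M h = (\<integral>x. h x * ln (h x) \<partial>M) - (\<integral>x. h x \<partial>M) * ln (\<integral>x. h x \<partial>M)"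

(* The entropy is that of a bounded function, hence finite (and nonnegative), whereas the
   energy on the right may be infinite; it is therefore a nonnegative Lebesgue integral. *)
definition log_Sobolev :: "(real^'n::finite) set \<Rightarrow> (real^'n) measure \<Rightarrow> real \<Rightarrow> bool" where
  "log_Sobolev G M c \<longleftrightarrow>
     (\<forall>g. smooth_on G g \<and> bounded (g ` G) \<longrightarrow>
        ennreal (Ent M (\<lambda>x. (g x)\<^sup>2)) \<le> ennreal (2 * c) * (\<integral>\<^sup>+x. ennreal ((norm (grad g x))\<^sup>2) \<partial>M))"

(* The k-linear form of the hypermatrix of k-th order partial derivatives;
   only the vectors v 0, ..., v (k - 1) matter. *)
definition deriv_form :: "nat \<Rightarrow> (real^'n::finite \<Rightarrow> real) \<Rightarrow> real^'n \<Rightarrow> (nat \<Rightarrow> real^'n) \<Rightarrow> real" where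
  "deriv_form k f x v =
     (\<Sum>is\<in>{is. length is = k}. iterated_partial is f x * (\<Prod>j<k. v j $ (is ! j)))"

definition op_norm :: "nat \<Rightarrow> (real^'n::finite \<Rightarrow> real) \<Rightarrow> real^'n \<Rightarrow> real" where
  "op_norm k f x = (SUP v\<in>{v. \<forall>j<k. norm (v j) = 1}. deriv_form k f x v)"

(* Powers of extended nonnegative numbers, for exponents a > 0. *)
definition ennpowr :: "ennreal \<Rightarrow> real \<Rightarrow> ennreal" where
  "ennpowr x a = (if x = \<infinity> then \<infinity> else ennreal (enn2real x powr a))"

definition op_norm_Lp :: "(real^'n::finite) measure \<Rightarrow> ennreal \<Rightarrow> nat \<Rightarrow> (real^'n \<Rightarrow> real) \<Rightarrow> ennreal" where
  "op_norm_Lp M p k f =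
     (if p = \<infinity> then esssup M (\<lambda>x. ennreal (op_norm k f x))
      else ennpowr (\<integral>\<^sup>+x. ennpowr (ennreal (op_norm k f x)) (enn2real p) \<partial>M) (1 / enn2real p))"

(* In ennreal: a / 0 = \<infinity> for a > 0, 0 / 0 = 0, a / \<infinity> = 0, and the infimum over
   the empty set (d = 1) is \<infinity>. *)
definition eta :: "(real^'n::finite) measure \<Rightarrow> real \<Rightarrow> nat \<Rightarrow> (real^'n \<Rightarrow> real) \<Rightarrow> real \<Rightarrow> ennreal" where
  "eta M \<sigma> d f t =
     min (ennreal (t powr (2 / real d)) / (ennreal (\<sigma>\<^sup>2) * ennpowr (op_norm_Lp M \<infinity> d f) (2 / real d)))
         (INF k\<in>{1..<d}.
            ennreal (t powr (2 / real k)) / (ennreal (\<sigma>\<^sup>2) * ennpowr (op_norm_Lp M 2 k f) (2 / real k)))"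

definition exp_neg :: "ennreal \<Rightarrow> real" where
  "exp_neg x = (if x = \<infinity> then 0 else exp (- enn2real x))"

end

theory Submission
  imports Defs
begin

text \<open>
  For a \<open>C\<^sup>1\<close> function \<open>u\<close> the logarithmic Sobolev inequality, applied to \<open>\<bar>u\<bar> powr (q / 2)\<close>, bounds the
  derivative in \<open>q\<close> of \<open>\<parallel>u\<parallel>\<^sub>q\<^sup>2\<close> and yields
  \<open>\<parallel>u\<parallel>\<^sub>p\<^sup>2 \<le> \<parallel>u\<parallel>\<^sub>2\<^sup>2 + \<sigma>\<^sup>2 (p - 2) \<parallel>\<nabla>u\<parallel>\<^sub>p\<^sup>2\<close> for \<open>p \<ge> 2\<close>. The gradient of the operator norm of the \<open>k\<close>-th derivative is
  bounded by the operator norm of the next one, so iterating and starting with the Poincare inequality gives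
  \<open>\<parallel>f\<parallel>\<^sub>p\<^sup>2 \<le> \<Sum>\<^sub>k (\<sigma>\<^sup>2 p)\<^sup>k \<parallel>f\<^sup>(\<^sup>k\<^sup>)\<parallel>\<^sup>2\<close>, with the \<open>L\<^sup>2\<close> norm for \<open>k < d\<close> and the sup norm for \<open>k = d\<close>.
  For \<open>p = \<eta>(t) / (d e)\<^sup>2\<close> the right-hand side is at most \<open>(t / e)\<^sup>2\<close>, and Markov's inequality gives \<open>e\<^sup>-\<^sup>p\<close>; for \<open>p < 2\<close> the
  claim is trivial.

  The hypothesis concerns smooth functions only, whereas \<open>f\<close> is merely \<open>C\<^sup>d\<close> and an operator norm need not be
  differentiable. \<open>C\<^sup>1\<close> functions on \<open>G\<close> are approximated uniformly together with their gradients by mollifying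
  the pieces of a locally finite partition of unity, each at its own scale; the operator norm
  is the limit of soft maxima of finitely many values of the derivative form.
\<close>

section \<open>Functions of class \<open>C\<^sup>k\<close> and a smooth cutoff\<close>

text \<open>Only order d needs a sup norm because each step trades the \<open>L^p\<close> norm of a
  function for its own \<open>L^2\<close> norm plus the \<open>L^p\<close> norm of its gradient: the
  demand for high integrability is only handed on to the next derivative, and at order d the sup
  norm meets it for every p at once. Nothing beyond integrability of f is assumed about its moments,
  while the entropy argument needs bounded functions that stay away from 0. Hence the truncations:
  they do not enlarge the gradient, and Fatou's lemma yields integrability of the limit along with
  its bound. Constants: the e inside \<open>(d e)^2\<close> turns Markov's quotient into
  \<open>e^-p\<close>, and the d more than covers the d terms of the sum. Order 0 costs no extra
  term, since Poincare's constant and the factor p - 2 add up to p - 1.\<close>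

lemma partial_deriv_eq:
  assumes "(f has_derivative D) (at x)"
  shows "partial_deriv i f x = D (axis i 1)"
proof -
  have D: "(f has_derivative D) (at (x + 0 *\<^sub>R axis i 1))"
    using assms by simp
  have "((\<lambda>h::real. x + h *\<^sub>R axis i 1) has_derivative (\<lambda>h. h *\<^sub>R axis i 1)) (at 0)"
    by (auto intro!: derivative_eq_intros)
  from has_derivative_compose[OF this D]
  have "((\<lambda>h. f (x + h *\<^sub>R axis i 1)) has_derivative (\<lambda>h. D (h *\<^sub>R axis i 1))) (at 0)"
    by simp
  moreover have "(\<lambda>h. D (h *\<^sub>R axis i 1)) = (*) (D (axis i 1))"
    using linear_scale[OF has_derivative_linear[OF assms]] by (auto simp: mult.commute)
  ultimately show ?thesis
    unfolding partial_deriv_def by (intro DERIV_imp_deriv) (simp add: has_field_derivative_def)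
qed

lemma inner_grad_axis: "grad f x \<bullet> axis i 1 = partial_deriv i f x"
  by (simp add: grad_def inner_axis)

lemma has_derivative_grad:
  assumes "f differentiable (at x)"
  shows "(f has_derivative (\<lambda>h. grad f x \<bullet> h)) (at x)"
proof -
  obtain D where D: "(f has_derivative D) (at x)"
    using assms by (auto simp: differentiable_def)
  interpret linear D by (rule has_derivative_linear[OF D])
  have "D h = grad f x \<bullet> h" for h
  proof -
    have "D h = D (\<Sum>i\<in>UNIV. h $ i *\<^sub>R axis i 1)"
      using basis_expansion[of h] by (simp add: scalar_mult_eq_scaleR)
    also have "\<dots> = (\<Sum>i\<in>UNIV. h $ i * partial_deriv i f x)"
      using D by (simp add: sum scale partial_deriv_eq)
    finally show ?thesis
      by (simp add: inner_vec_def grad_def mult.commute)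
  qed
  then show ?thesis using D by (metis has_derivative_eq_rhs ext)
qed

lemma grad_eqI:
  assumes "(f has_derivative (\<lambda>h. v \<bullet> h)) (at x)"
  shows "grad f x = v"
  by (simp add: vec_eq_iff grad_def partial_deriv_eq[OF assms] inner_axis)

lemma partial_deriv_cong:
  assumes "open G" "x \<in> G" "\<And>y. y \<in> G \<Longrightarrow> f y = g y"
  shows "partial_deriv i f x = partial_deriv i g x"
  unfolding partial_deriv_def
proof (rule deriv_cong_ev)
  have "isCont (\<lambda>h::real. x + h *\<^sub>R axis i 1) 0" by (intro continuous_intros)
  then have "((\<lambda>h::real. x + h *\<^sub>R axis i 1) \<longlongrightarrow> x) (nhds 0)"
    using tendsto_at_iff_tendsto_nhds[of "\<lambda>h::real. x + h *\<^sub>R axis i 1" 0] by (simp add: isCont_def)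
  then have "\<forall>\<^sub>F h in nhds 0. x + h *\<^sub>R axis i 1 \<in> G"
    using assms(1,2) by (rule topological_tendstoD)
  then show "\<forall>\<^sub>F h in nhds 0. f (x + h *\<^sub>R axis i 1) = g (x + h *\<^sub>R axis i 1)"
    by eventually_elim (rule assms(3))
qed simp

lemma grad_cong:
  assumes "open G" "x \<in> G" "\<And>y. y \<in> G \<Longrightarrow> f y = g y"
  shows "grad f x = grad g x"
  using partial_deriv_cong[OF assms] by (simp add: grad_def)

lemma differentiable_cong_open:
  assumes "open G" "x \<in> G" "\<And>y. y \<in> G \<Longrightarrow> f y = g y" "f differentiable (at x)"
  shows "g differentiable (at x)"
  using assms unfolding differentiable_def
  by (metis has_derivative_transform_within_open)

lemma C_on_cong:
  assumes "open G" "\<And>y. y \<in> G \<Longrightarrow> f y = g y" "C_on k G f"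
  shows "C_on k G g"
  using assms(2,3)
proof (induction k arbitrary: f g)
  case 0
  then show ?case by (simp add: continuous_on_cong[of G G f g])
next
  case (Suc k)
  have "C_on k G (partial_deriv i g)" for i
    by (rule Suc.IH[of "partial_deriv i f"])
      (use Suc.prems assms(1) in \<open>auto intro: partial_deriv_cong\<close>)
  then show ?case
    using Suc.prems assms(1) by (auto intro: differentiable_cong_open[of G _ f])
qed

lemma C_on_subset: "C_on k G f \<Longrightarrow> H \<subseteq> G \<Longrightarrow> C_on k H f"
  by (induction k arbitrary: f) (auto intro: continuous_on_subset)

text \<open>Smoothness is local. This is what later glues a locally finite sum from its finite
  partial sums on the members of an open cover.\<close>

lemma C_on_Union:
  assumes "\<And>G. G \<in> \<G> \<Longrightarrow> open G \<and> C_on k G f"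
  shows "C_on k (\<Union>\<G>) f"
  using assms
proof (induction k arbitrary: f)
  case 0
  then show ?case
    using continuous_on_open_Union[of \<G> f] by auto
next
  case (Suc k)
  then show ?case by fastforce
qed

lemma C_on_Un: "open G \<Longrightarrow> open H \<Longrightarrow> C_on k G f \<Longrightarrow> C_on k H f \<Longrightarrow> C_on k (G \<union> H) f"
  using C_on_Union[of "{G, H}" k f] by auto

lemma C_on_Suc_imp: "C_on (Suc k) G f \<Longrightarrow> C_on k G f"
proof (induction k arbitrary: f)
  case 0
  then show ?case
    by (auto intro!: continuous_at_imp_continuous_on differentiable_imp_continuous_within)
next
  case (Suc k)
  then show ?case by (metis C_on.simps(2))
qed

lemma C_on_mono:
  assumes "C_on k G f" "j \<le> k" shows "C_on j G f"
  using assms(2,1) by (induction k rule: dec_induct) (auto intro: C_on_Suc_imp simp del: C_on.simps)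

lemma C_on_imp_continuous: "C_on k G f \<Longrightarrow> continuous_on G f"
  using C_on_mono[of k G f 0] by simp

text \<open>Taking the derivative as a linear map makes the standard derivative rules applicable.
  Closure under sums, products and composition then follows by induction on the order.\<close>

lemma C_on_SucI:
  assumes "open G" and D: "\<And>x. x \<in> G \<Longrightarrow> (f has_derivative D x) (at x)"
    and C: "\<And>i. C_on k G (\<lambda>x. D x (axis i 1))"
  shows "C_on (Suc k) G f"
proof -
  have "C_on k G (partial_deriv i f)" for i
    by (rule C_on_cong[OF \<open>open G\<close> _ C[of i]]) (simp add: partial_deriv_eq[OF D])
  then show ?thesis using D by (auto simp: differentiable_def)
qed

lemma C_on_Suc_derivative: "C_on (Suc k) G f \<Longrightarrow> x \<in> G \<Longrightarrow> (f has_derivative (\<lambda>h. grad f x \<bullet> h)) (at x)"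
  by (intro has_derivative_grad) auto

lemma C_on_Suc_partial: "C_on (Suc k) G f \<Longrightarrow> C_on k G (\<lambda>x. grad f x \<bullet> axis i 1)"
  by (simp add: inner_grad_axis eta_contract_eq)

lemma C_on_const: "open G \<Longrightarrow> C_on k G (\<lambda>x. c)"
proof (induction k arbitrary: c)
  case (Suc k)
  show ?case by (rule C_on_SucI[where D="\<lambda>x h. 0"]) (use Suc in auto)
qed simp

lemma C_on_inner: "open G \<Longrightarrow> C_on k G (\<lambda>x. x \<bullet> v)"
proof (cases k)
  case (Suc j)
  assume "open G"
  then show ?thesis unfolding Suc
    by (intro C_on_SucI[where D="\<lambda>x h. h \<bullet> v"]) (auto intro!: derivative_eq_intros C_on_const)
qed (auto intro!: continuous_intros)

lemma C_on_add:
  assumes "open G" "C_on k G f" "C_on k G g"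
  shows "C_on k G (\<lambda>x. f x + g x)"
  using assms(2,3)
proof (induction k arbitrary: f g)
  case (Suc k)
  show ?case
    by (rule C_on_SucI[where D="\<lambda>x h. grad f x \<bullet> h + grad g x \<bullet> h", OF \<open>open G\<close>])
      (auto intro!: derivative_intros C_on_Suc_derivative Suc.IH C_on_Suc_partial Suc.prems simp del: C_on.simps)
qed (auto intro: continuous_intros)

lemma C_on_mult:
  assumes "open G" "C_on k G f" "C_on k G g"
  shows "C_on k G (\<lambda>x. f x * g x)"
  using assms(2,3)
proof (induction k arbitrary: f g)
  case (Suc k)
  show ?case
    by (rule C_on_SucI[where D="\<lambda>x h. f x * (grad g x \<bullet> h) + (grad f x \<bullet> h) * g x", OF \<open>open G\<close>])
      (auto intro!: derivative_intros C_on_Suc_derivative Suc.IH C_on_Suc_partial Suc.prems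
          C_on_add assms(1) simp del: C_on.simps dest: C_on_Suc_imp intro: C_on_Suc_imp)
qed (auto intro: continuous_intros)

lemma C_on_diff:
  assumes "open G" "C_on k G f" "C_on k G g"
  shows "C_on k G (\<lambda>x. f x - g x)"
  using C_on_add[OF assms(1,2) C_on_mult[OF assms(1) C_on_const[OF assms(1), of k "-1"] assms(3)]] by simp

lemma C_on_sum:
  assumes "open G" "\<And>a. a \<in> A \<Longrightarrow> C_on k G (f a)"
  shows "C_on k G (\<lambda>x. \<Sum>a\<in>A. f a x)"
  using assms(2) by (induction A rule: infinite_finite_induct) (auto intro: C_on_const C_on_add assms(1))

lemma C_on_prod:
  assumes "open G" "\<And>a. a \<in> A \<Longrightarrow> C_on k G (f a)"
  shows "C_on k G (\<lambda>x. \<Prod>a\<in>A. f a x)"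
  using assms(2) by (induction A rule: infinite_finite_induct) (auto intro: C_on_const C_on_mult assms(1))

section \<open>A flat function and a smooth cutoff\<close>

text \<open>Division by powers of t makes the family closed under differentiation up to linear
  combinations, so smoothness of every order follows by one induction for all \<open>m\<close>
  together.\<close>

definition flat :: "nat \<Rightarrow> real \<Rightarrow> real" where
  "flat m t = (if t \<le> 0 then 0 else exp (- (1 / t)) / t ^ m)"

lemma flat_tendsto_0: "((\<lambda>t. flat m t) \<longlongrightarrow> 0) (at 0)"
proof -
  have "((\<lambda>t. exp (- (1 / t)) / t ^ m) \<longlongrightarrow> (0::real)) (at_right 0)"
  proof -
    have "((\<lambda>x::real. (inverse x) ^ m / exp (inverse x)) \<longlongrightarrow> 0) (at_right 0)"
      by (rule filterlim_compose[OF tendsto_power_div_exp_0 filterlim_inverse_at_top_right])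
    then show ?thesis
      by (simp add: exp_minus field_simps)
  qed
  moreover have "\<forall>\<^sub>F t in at_right 0. exp (- (1 / t)) / t ^ m = flat m t"
    by (auto simp: eventually_at_filter flat_def)
  ultimately have "((\<lambda>t. flat m t) \<longlongrightarrow> 0) (at_right 0)"
    using tendsto_cong by fastforce
  moreover have "((\<lambda>t. flat m t) \<longlongrightarrow> 0) (at_left 0)"
    by (rule tendsto_eventually) (auto simp: eventually_at_filter flat_def)
  ultimately show ?thesis by (simp add: filterlim_at_split)
qed

lemma flat_has_derivative:
  "(flat m has_field_derivative (flat (m + 2) t - m * flat (m + 1) t)) (at t)"
proof (cases t "0::real" rule: linorder_cases)
  case less
  have "((\<lambda>t::real. 0) has_field_derivative 0) (at t)" by simp
  moreover have "\<forall>\<^sub>F s in nhds t. 0 = flat m s"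
    by (rule eventually_mono[OF eventually_nhds_in_open[of "{..<0}" t]]) (use less in \<open>auto simp: flat_def\<close>)
  ultimately have "(flat m has_field_derivative 0) (at t)"
    using DERIV_cong_ev[of t t "\<lambda>t. 0" "flat m" 0 0] by blast
  then show ?thesis using less by (simp add: flat_def)
next
  case equal
  \<comment> \<open>At 0 the difference quotient of \<open>flat m\<close> is
    \<open>flat (m + 1)\<close> itself, whose limit is known.\<close>
  have "((\<lambda>h. (flat m (0 + h) - flat m 0) / h) \<longlongrightarrow> 0) (at 0)"
  proof (rule Lim_transform_eventually[OF flat_tendsto_0[of "m + 1"]])
    show "\<forall>\<^sub>F h in at 0. flat (m + 1) h = (flat m (0 + h) - flat m 0) / h"
      by (auto simp: flat_def eventually_at_filter)
  qed
  then show ?thesis using equal by (simp add: DERIV_def flat_def)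
next
  case greater
  have "((\<lambda>t. exp (- (1 / t)) / t ^ m) has_field_derivative
      (exp (- (1 / t)) / t ^ (m + 2) - m * (exp (- (1 / t)) / t ^ (m + 1)))) (at t)"
  proof -
    have "((\<lambda>t. exp (- (1 / t)) / t ^ m) has_field_derivative
      ((exp (- (1 / t)) * (1 / t^2)) * t ^ m - exp (- (1 / t)) * (m * t ^ (m - 1))) / (t ^ m * t ^ m)) (at t)"
      using greater by (auto intro!: derivative_eq_intros simp: power2_eq_square)
    moreover have "((exp (- (1 / t)) * (1 / t^2)) * t ^ m - exp (- (1 / t)) * (m * t ^ (m - 1))) / (t ^ m * t ^ m)
       = exp (- (1 / t)) / t ^ (m + 2) - m * (exp (- (1 / t)) / t ^ (m + 1))"
      using greater by (cases m) (auto simp: field_simps power2_eq_square)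
    ultimately show ?thesis by simp
  qed
  moreover have "\<forall>\<^sub>F s in nhds t. exp (- (1 / s)) / s ^ m = flat m s"
    by (rule eventually_mono[OF eventually_nhds_in_open[of "{0<..}" t]]) (use greater in \<open>auto simp: flat_def\<close>)
  ultimately have "(flat m has_field_derivative
     (exp (- (1 / t)) / t ^ (m + 2) - m * (exp (- (1 / t)) / t ^ (m + 1)))) (at t)"
    using DERIV_cong_ev[of t t "\<lambda>s. exp (- (1 / s)) / s ^ m" "flat m"] by blast
  then show ?thesis using greater by (simp add: flat_def)
qed

lemma C_on_flat:
  assumes "open G" "C_on k G q"
  shows "C_on k G (\<lambda>x. flat m (q x))"
  using assms(2)
proof (induction k arbitrary: m)
  case 0
  have "continuous_on UNIV (flat m)"
    using flat_has_derivative by (auto intro!: DERIV_isCont continuous_at_imp_continuous_on)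
  then show ?case using 0 continuous_on_compose2[of UNIV "flat m" G q] by auto
next
  case (Suc k)
  let ?D = "\<lambda>x h. (flat (m + 2) (q x) - m * flat (m + 1) (q x)) * (grad q x \<bullet> h)"
  have "((\<lambda>x. flat m (q x)) has_derivative ?D x) (at x)" if "x \<in> G" for x
    using has_derivative_compose[OF C_on_Suc_derivative[OF Suc.prems that]
        flat_has_derivative[unfolded has_field_derivative_def]] by simp
  then show ?case
    by (rule C_on_SucI[OF \<open>open G\<close>])
      (auto intro!: C_on_mult C_on_diff C_on_const assms(1) Suc.IH C_on_Suc_partial
        Suc.prems C_on_Suc_imp[OF Suc.prems] simp del: C_on.simps)
qed

lemma C_on_norm_sq: "open G \<Longrightarrow> C_on k G (\<lambda>x. (norm (x - c))\<^sup>2)"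
proof -
  assume G: "open G"
  have "(norm (x - c))\<^sup>2 = (\<Sum>i\<in>UNIV. (x $ i - c $ i) * (x $ i - c $ i))" for x
    by (simp add: power2_norm_eq_inner inner_vec_def)
  then have "(\<lambda>x. (norm (x - c))\<^sup>2) = (\<lambda>x. \<Sum>i\<in>UNIV. (x \<bullet> axis i 1 - c $ i) * (x \<bullet> axis i 1 - c $ i))"
    by (simp add: inner_axis)
  then show ?thesis
    by (simp only:) (intro C_on_sum C_on_mult C_on_diff C_on_inner C_on_const G)
qed

text \<open>The outer \<open>flat\<close> is only ever evaluated at \<open>1\<close> near the centre and at nonpositive
  arguments far away, so no quotient of flat functions is needed.\<close>
definition cutoff :: "real^'n::finite \<Rightarrow> real \<Rightarrow> real^'n \<Rightarrow> real" where
  "cutoff c r x = exp 1 * flat 0 (1 - exp 1 * flat 0 ((norm (x - c))\<^sup>2 / r\<^sup>2 - 1))"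

lemma C_on_cutoff: "C_on k UNIV (cutoff c r)"
  unfolding cutoff_def divide_inverse
  by (intro C_on_mult C_on_const C_on_flat C_on_diff C_on_norm_sq open_UNIV)

lemma cutoff_eq_1: "r > 0 \<Longrightarrow> dist c x \<le> r \<Longrightarrow> cutoff c r x = 1"
  by (auto simp: cutoff_def flat_def dist_norm norm_minus_commute power_mono divide_le_eq_1
      simp flip: exp_add)

lemma cutoff_eq_0:
  assumes "r > 0" "dist c x \<ge> 2 * r" shows "cutoff c r x = 0"
proof -
  define s where "s = (norm (x - c))\<^sup>2 / r\<^sup>2 - 1"
  have "(norm (x - c))\<^sup>2 \<ge> (2 * r)\<^sup>2"
    using assms by (intro power_mono) (auto simp: dist_norm norm_minus_commute)
  then have "2 * r\<^sup>2 \<le> (norm (x - c))\<^sup>2"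
    using zero_le_power2[of r] by (auto simp: power_mult_distrib intro: order_trans[rotated])
  \<comment> \<open>From 1 on, \<open>exp 1 * flat 0 s\<close> is at least 1, so the argument of the
    outer \<open>flat\<close> is nonpositive.\<close>
  then have "s \<ge> 1" using assms(1) by (simp add: s_def field_simps)
  then have "exp 1 * flat 0 s \<ge> 1"
    by (simp add: flat_def flip: exp_add)
  then show ?thesis by (simp add: cutoff_def flat_def flip: s_def)
qed

section \<open>Mollification\<close>

definition conv :: "('a::euclidean_space \<Rightarrow> real) \<Rightarrow> ('a \<Rightarrow> real) \<Rightarrow> 'a \<Rightarrow> real" where
  "conv k K x = (\<integral>y. k y * K (x - y) \<partial>lborel)"

text \<open>Links the Lebesgue integral, in which convolutions are defined, with the gauge integral
  over a box, in which differentiation under the integral sign takes place.\<close>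

lemma compact_support_integral:
  fixes g :: "'a::euclidean_space \<Rightarrow> real"
  assumes "continuous_on UNIV g" "\<And>x. x \<notin> cbox a b \<Longrightarrow> g x = 0"
  shows "integrable lborel g" "integral\<^sup>L lborel g = integral (cbox a b) g"
proof -
  have "integrable lborel (\<lambda>x. indicator (cbox a b) x *\<^sub>R g x)"
    by (rule borel_integrable_compact) (auto intro: continuous_on_subset assms(1))
  moreover have eq: "(\<lambda>x. indicator (cbox a b) x *\<^sub>R g x) = g"
    using assms(2) by (auto simp: fun_eq_iff indicator_def of_bool_def)
  ultimately show int: "integrable lborel g" by simp
  have "integral\<^sup>L lborel g = integral UNIV g"
    using integral_lborel[OF int] by simp
  also have "\<dots> = integral UNIV (\<lambda>x. if x \<in> cbox a b then g x else 0)"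
    using assms(2) by (intro integral_cong) auto
  also have "\<dots> = integral (cbox a b) g" by (rule integral_restrict_UNIV)
  finally show "integral\<^sup>L lborel g = integral (cbox a b) g" .
qed

lemma integral_lborel_reflect:
  fixes g :: "'a::euclidean_space \<Rightarrow> real"
  assumes [measurable]: "g \<in> borel_measurable borel"
  shows "(\<integral>y. g (x - y) \<partial>lborel) = (\<integral>y. g y \<partial>lborel)"
proof -
  have "(lborel :: 'a measure) = distr lborel borel (\<lambda>y. x - y)"
    using lborel_affine[of "-1::real" x] by (simp add: density_1)
  then have "(\<integral>y. g y \<partial>lborel) = (\<integral>y. g y \<partial>distr lborel borel (\<lambda>y. x - y))"
    by simp
  also have "\<dots> = (\<integral>y. g (x - y) \<partial>lborel)"
    by (rule integral_distr) auto
  finally show ?thesis by simp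
qed

text \<open>Lets one convolution be differentiated on either factor: on the mollifier to see that it
  is smooth, on the mollified function to compare gradients.\<close>

lemma conv_commute:
  assumes "continuous_on UNIV k" "continuous_on UNIV K"
  shows "conv k K x = conv K k x"
proof -
  have "continuous_on UNIV (\<lambda>y. k y * K (x - y))"
    by (intro continuous_intros assms(1) continuous_on_compose2[OF assms(2)]) auto
  then have "(\<lambda>y. k y * K (x - y)) \<in> borel_measurable borel"
    by (rule borel_measurable_continuous_onI)
  from integral_lborel_reflect[OF this, of x] show ?thesis
    by (simp add: conv_def mult.commute)
qed

lemma continuous_on_grad: "C_on (Suc 0) G f \<Longrightarrow> continuous_on G (grad f)"
  unfolding grad_def by (intro continuous_on_vec_lambda) simp

text \<open>The compactly supported factor \<open>k\<close> confines the integral to a box, where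
  the Leibniz rule applies; the derivative falls on \<open>K\<close> alone.\<close>

lemma conv_has_derivative:
  fixes k :: "real^'n::finite \<Rightarrow> real"
  assumes k: "continuous_on UNIV k" "\<And>x. x \<notin> cbox a b \<Longrightarrow> k x = 0"
    and K: "C_on (Suc 0) UNIV K"
  obtains D where "(conv k K has_derivative D) (at x)"
    "\<And>i. D (axis i 1) = conv k (partial_deriv i K) x"
proof -
  let ?fx = "\<lambda>x t. k t *\<^sub>R blinfun_inner_right (grad K (x - t))"
  have contK: "continuous_on UNIV K" "continuous_on UNIV (grad K)" "\<And>i. continuous_on UNIV (partial_deriv i K)"
    using C_on_imp_continuous[OF K] continuous_on_grad[OF K] K by auto
  have cont: "continuous_on UNIV (\<lambda>y. k y * K' (x - y))" if "continuous_on UNIV K'" for K' :: "_ \<Rightarrow> real" and x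
    by (intro continuous_intros k(1) continuous_on_compose2[OF that]) auto
  have conv_eq: "conv k K' x = integral (cbox a b) (\<lambda>y. k y * K' (x - y))" if "continuous_on UNIV K'" for K' x
    unfolding conv_def by (rule compact_support_integral(2)[OF cont[OF that]]) (simp add: k(2))
  have contfx: "continuous_on (UNIV \<times> cbox a b) (\<lambda>(x, t). ?fx x t)"
    unfolding split_beta
    by (intro continuous_intros continuous_on_compose2[OF k(1)] continuous_on_compose2[OF contK(2)]
        bounded_linear.continuous_on[OF bounded_linear_blinfun_inner_right]) auto
  have "((\<lambda>x. integral (cbox a b) (\<lambda>y. k y * K (x - y))) has_derivative
      integral (cbox a b) (?fx x)) (at x within UNIV)"
  proof (rule leibniz_rule[OF _ _ contfx])
    fix x t
    have "((\<lambda>x. K (x - t)) has_derivative (\<lambda>h. grad K (x - t) \<bullet> h)) (at x)"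
    proof -
      have "((\<lambda>x. x - t) has_derivative (\<lambda>h. h)) (at x)" by (auto intro!: derivative_eq_intros)
      from has_derivative_compose[OF this C_on_Suc_derivative[OF K UNIV_I]] show ?thesis .
    qed
    then show "((\<lambda>x. k t * K (x - t)) has_derivative blinfun_apply (?fx x t)) (at x within UNIV)"
      by (auto intro!: derivative_eq_intros simp: blinfun.scaleR_left)
  next
    fix x
    show "(\<lambda>y. k y * K (x - y)) integrable_on cbox a b"
      by (rule integrable_continuous) (rule continuous_on_subset[OF cont[OF contK(1)]], simp)
  qed auto
  moreover have "blinfun_apply (integral (cbox a b) (?fx x)) (axis i 1) = conv k (partial_deriv i K) x" for i
  proof -
    have "?fx x integrable_on cbox a b"
      by (intro integrable_continuous continuous_intros continuous_on_compose2[OF k(1)]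
          continuous_on_compose2[OF contK(2)] bounded_linear.continuous_on[OF bounded_linear_blinfun_inner_right]) auto
    then have "blinfun_apply (integral (cbox a b) (?fx x)) (axis i 1)
        = integral (cbox a b) (\<lambda>t. blinfun_apply (?fx x t) (axis i 1))"
      by (subst blinfun_apply_integral) auto
    also have "\<dots> = conv k (partial_deriv i K) x"
      by (simp add: conv_eq[OF contK(3)] blinfun.scaleR_left inner_grad_axis)
    finally show ?thesis .
  qed
  moreover have "conv k K = (\<lambda>x. integral (cbox a b) (\<lambda>y. k y * K (x - y)))"
    using conv_eq[OF contK(1)] by auto
  ultimately show ?thesis
    using that[of "blinfun_apply (integral (cbox a b) (?fx x))"] by simp
qed

lemma partial_deriv_conv:
  assumes "continuous_on UNIV k" "\<And>x. x \<notin> cbox a b \<Longrightarrow> k x = 0" "C_on (Suc 0) UNIV K"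
  shows "partial_deriv i (conv k K) x = conv k (partial_deriv i K) x"
  by (rule conv_has_derivative[OF assms(1) assms(2) assms(3), where x=x]) (auto simp: partial_deriv_eq)

lemma smooth_conv:
  assumes k: "continuous_on UNIV k" "\<And>x. x \<notin> cbox a b \<Longrightarrow> k x = 0" and "smooth_on UNIV K"
  shows "smooth_on UNIV (conv k K)"
proof -
  have "C_on m UNIV (conv k K)" if "smooth_on UNIV K" for m K
    using that
  proof (induction m arbitrary: K)
    case (0 K)
    then have K: "C_on (Suc 0) UNIV K" by (auto simp: smooth_on_def)
    have "isCont (conv k K) x" for x
      by (rule conv_has_derivative[OF k(1) k(2) K, where x=x]) (auto intro: has_derivative_continuous)
    then show ?case by (simp add: continuous_at_imp_continuous_on)
  next
    case (Suc m K)
    then have K: "C_on (Suc 0) UNIV K" by (auto simp: smooth_on_def)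
    have "smooth_on UNIV (partial_deriv i K)" for i
      using Suc.prems C_on.simps(2) unfolding smooth_on_def by blast
    then have "C_on m UNIV (conv k (partial_deriv i K))" for i by (rule Suc.IH)
    moreover have "partial_deriv i (conv k K) = conv k (partial_deriv i K)" for i
      using partial_deriv_conv[OF k K] by auto
    moreover have "conv k K differentiable (at x)" for x
      by (rule conv_has_derivative[OF k(1) k(2) K, where x=x]) (auto simp: differentiable_def)
    ultimately show ?case by simp
  qed
  then show ?thesis using assms(3) by (simp add: smooth_on_def)
qed

lemma cball_subset_cbox:
  fixes R :: real
  shows "cball (0::real^'n::finite) R \<subseteq> cbox (\<chi> i. - R) (\<chi> i. R)"
  by (auto simp: mem_box_cart) (meson component_le_norm_cart abs_le_D1 abs_le_D2 order_trans minus_le_iff)+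

text \<open>The kernel is a probability density on a ball of radius \<open>s\<close>, so the
  convolution averages values of \<open>V\<close> that are all within \<open>e\<close> of
  \<open>V x\<close>. It is applied to a function and to each of its partial derivatives.\<close>

lemma conv_near:
  fixes \<rho> V :: "real^'n::finite \<Rightarrow> real"
  assumes \<rho>: "continuous_on UNIV \<rho>" "\<And>z. \<rho> z \<ge> 0" "\<And>z. norm z \<ge> s \<Longrightarrow> \<rho> z = 0" "(\<integral>z. \<rho> z \<partial>lborel) = 1"
    and V: "continuous_on UNIV V" "\<And>z. norm z < s \<Longrightarrow> \<bar>V (x - z) - V x\<bar> \<le> e"
  shows "\<bar>conv \<rho> V x - V x\<bar> \<le> e"
proof -
  have 0: "\<rho> z = 0" if "z \<notin> cbox (\<chi> i. - s) (\<chi> i. s)" for z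
    using cball_subset_cbox[of s] that \<rho>(3)[of z] by (cases "norm z \<le> s") (auto simp: subset_iff)
  have c: "continuous_on UNIV (\<lambda>z. \<rho> z * V (x - z))"
    by (intro continuous_intros \<rho>(1) continuous_on_compose2[OF V(1)]) auto
  have i1: "integrable lborel \<rho>"
    by (rule compact_support_integral(1)[OF \<rho>(1), of "\<chi> i. - s" "\<chi> i. s"]) (simp add: 0)
  have i2: "integrable lborel (\<lambda>z. \<rho> z * V (x - z))"
    by (rule compact_support_integral(1)[OF c, of "\<chi> i. - s" "\<chi> i. s"]) (simp add: 0)
  have "conv \<rho> V x - V x = (\<integral>z. \<rho> z * V (x - z) \<partial>lborel) - (\<integral>z. \<rho> z * V x \<partial>lborel)"
    by (simp add: conv_def \<rho>(4))
  also have "\<dots> = (\<integral>z. \<rho> z * (V (x - z) - V x) \<partial>lborel)"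
    using i1 i2 by (subst Bochner_Integration.integral_diff[symmetric]) (auto simp: algebra_simps)
  also have "\<bar>\<dots>\<bar> \<le> (\<integral>z. \<rho> z * e \<partial>lborel)"
  proof (rule integral_abs_bound_integral)
    show "integrable lborel (\<lambda>z. \<rho> z * (V (x - z) - V x))"
      using i1 i2 by (simp add: right_diff_distrib)
    show "integrable lborel (\<lambda>z. \<rho> z * e)" using i1 by simp
    fix z show "\<bar>\<rho> z * (V (x - z) - V x)\<bar> \<le> \<rho> z * e"
      using V(2)[of z] \<rho>(2,3)[of z] by (cases "norm z < s") (auto simp: abs_mult intro: mult_left_mono)
  qed
  finally show ?thesis by (simp add: \<rho>(4))
qed

lemma mollifier_exists:
  assumes "s > 0"
  obtains \<rho> :: "real^'n::finite \<Rightarrow> real" where "smooth_on UNIV \<rho>" "\<And>z. \<rho> z \<ge> 0"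
    "\<And>z. norm z \<ge> s \<Longrightarrow> \<rho> z = 0" "(\<integral>z. \<rho> z \<partial>lborel) = 1"
proof -
  define b where "b = (\<lambda>z::real^'n. flat 0 (s\<^sup>2 - (norm (z - 0))\<^sup>2))"
  have b: "C_on m UNIV b" for m
    unfolding b_def by (intro C_on_flat C_on_diff C_on_const C_on_norm_sq open_UNIV)
  have b0: "b z = 0" if "norm z \<ge> s" for z
    using power_mono[OF that, of 2] assms by (simp add: b_def flat_def)
  have bnn: "b z \<ge> 0" for z by (simp add: b_def flat_def)
  have cont: "continuous_on UNIV b" using b[of 0] by simp
  have int: "integrable lborel b"
    by (rule compact_support_integral(1)[OF cont, of "\<chi> i. - s" "\<chi> i. s"])
      (use b0 cball_subset_cbox[of s] in \<open>force simp: subset_iff\<close>)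
  \<comment> \<open>If the normalising constant vanished, the bump would be zero almost everywhere;
    but it is positive on a whole ball, which is not a null set.\<close>
  have "(\<integral>z. b z \<partial>lborel) \<noteq> 0"
  proof
    assume "(\<integral>z. b z \<partial>lborel) = 0"
    then have "AE z in lborel. b z = 0"
      using integral_nonneg_eq_0_iff_AE[OF int] bnn by auto
    then have "AE z in lborel. (z::real^'n) \<notin> ball 0 s"
    proof eventually_elim
      case (elim z)
      then show ?case using assms
        by (auto simp: b_def flat_def split: if_splits dest: power_strict_mono[of "norm z" s 2])
    qed
    then have "emeasure lborel (ball (0::real^'n) s) = 0"
      by (subst (asm) AE_iff_measurable[OF _ refl]) (auto simp: ball_def)
    then have "measure lborel (ball (0::real^'n) s) = 0" by (simp add: measure_def)
    then show False using content_ball_pos[of s "0::real^'n"] assms by simp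
  qed
  then have Z: "(\<integral>z. b z \<partial>lborel) > 0"
    using Bochner_Integration.integral_nonneg[of lborel b] bnn by (auto simp: less_le)
  show ?thesis
  proof
    show "smooth_on UNIV (\<lambda>z. inverse (\<integral>z. b z \<partial>lborel) * b z)"
      unfolding smooth_on_def by (intro allI C_on_mult C_on_const b open_UNIV)
  qed (use Z b0 bnn in auto)
qed

text \<open>Uniform continuity of the pair of \<open>U\<close> and its gradient lets one
  mollification scale serve both. The last conclusion, that the support spreads by at most \<delta>,
  is what keeps a sum of such mollifications locally finite.\<close>

lemma mollify:
  fixes U :: "real^'n::finite \<Rightarrow> real"
  assumes U: "C_on (Suc 0) UNIV U" and supp: "\<And>x. norm x > R \<Longrightarrow> U x = 0" and "e > 0" "\<delta> > 0"
  obtains p where "smooth_on UNIV p" "\<And>x. \<bar>p x - U x\<bar> \<le> e" "\<And>x. norm (grad p x - grad U x) \<le> e"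
    "\<And>x. (\<And>y. dist x y < \<delta> \<Longrightarrow> U y = 0) \<Longrightarrow> p x = 0"
proof -
  define W where "W x = (U x, grad U x)" for x
  have gU: "continuous_on UNIV (grad U)" "continuous_on UNIV U"
    using continuous_on_grad[OF U] C_on_imp_continuous[OF U] by auto
  have contW: "continuous_on UNIV W"
    unfolding W_def by (intro continuous_intros gU)
  have g0: "grad U x = 0" if "norm x > R" for x
  proof -
    have "grad U x = grad (\<lambda>x. 0) x"
      by (rule grad_cong[of "- cball 0 R"]) (use that supp in \<open>auto simp: open_Compl\<close>)
    also have "\<dots> = 0" by (rule grad_eqI) simp
    finally show ?thesis .
  qed
  \<comment> \<open>Gradients are compared componentwise with tolerance \<open>e / N\<close>; the
    \<open>l^1\<close> bound on the norm adds the N components up to \<open>e\<close>.\<close>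
  define N where "N = real CARD('n)"
  have N: "N \<ge> 1" unfolding N_def using zero_less_card_finite[where 'a='n] by linarith
  have "uniformly_continuous_on (cball 0 (R + 1)) W"
    by (rule compact_uniformly_continuous) (auto intro: continuous_on_subset[OF contW])
  then obtain s0 where s0: "s0 > 0"
    "\<And>x y. x \<in> cball 0 (R + 1) \<Longrightarrow> y \<in> cball 0 (R + 1) \<Longrightarrow> dist y x < s0 \<Longrightarrow> dist (W y) (W x) < e / N"
    using \<open>e > 0\<close> N unfolding uniformly_continuous_on_def by (elim allE[of _ "e / N"]) auto
  \<comment> \<open>The three caps serve the modulus of continuity, the passage from radius R to R +
    1, and the spread of the support.\<close>
  define s where "s = min (min s0 1) \<delta>"
  have s: "s > 0" "s \<le> s0" "s \<le> 1" "s \<le> \<delta>" using s0 \<open>\<delta> > 0\<close> by (auto simp: s_def)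
  have W: "dist (W (x - z)) (W x) \<le> e / N" if z: "norm z < s" for x z
  proof (cases "norm x \<le> R + 1 \<and> norm (x - z) \<le> R + 1")
    case True
    then show ?thesis using s0(2)[of x "x - z"] z s by (simp add: dist_norm norm_minus_commute)
  next
    case False
    \<comment> \<open>A shift shorter than 1 cannot lead from beyond radius R + 1 back to radius R,
      so \<open>W\<close> vanishes at both points.\<close>
    then have "norm x > R" "norm (x - z) > R"
      using norm_triangle_ineq4[of x z] norm_triangle_ineq2[of x z] z s by auto
    then show ?thesis using supp g0 \<open>e > 0\<close> N by (simp add: W_def)
  qed
  obtain \<rho> :: "real^'n \<Rightarrow> real" where \<rho>: "smooth_on UNIV \<rho>" "\<And>z. \<rho> z \<ge> 0"
    "\<And>z. norm z \<ge> s \<Longrightarrow> \<rho> z = 0" "(\<integral>z. \<rho> z \<partial>lborel) = 1"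
    using mollifier_exists[OF s(1)] by blast
  have c\<rho>: "continuous_on UNIV \<rho>" using \<rho>(1) C_on.simps(1) unfolding smooth_on_def by blast
  have \<rho>0: "\<rho> z = 0" if "z \<notin> cbox (\<chi> i. - s) (\<chi> i. s)" for z
    using cball_subset_cbox[of s] that \<rho>(3)[of z] by (cases "norm z \<le> s") (auto simp: subset_iff)
  have U0: "U z = 0" if "z \<notin> cbox (\<chi> i. - R) (\<chi> i. R)" for z
    using cball_subset_cbox[of R] that supp[of z] by (cases "norm z \<le> R") (auto simp: subset_iff)
  have comm: "conv U \<rho> = conv \<rho> U"
    using conv_commute[OF gU(2) c\<rho>] by auto
  show ?thesis
  proof
    show "smooth_on UNIV (conv U \<rho>)"
      by (rule smooth_conv[OF gU(2) U0 \<rho>(1)])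
    have eN: "e / N \<le> e" using N \<open>e > 0\<close> by (simp add: field_simps)
    show "\<bar>conv U \<rho> x - U x\<bar> \<le> e" for x
      unfolding comm
    proof (rule conv_near[OF c\<rho> \<rho>(2-4) gU(2)])
      show "\<bar>U (x - z) - U x\<bar> \<le> e" if "norm z < s" for z
        using W[OF that, of x] dist_fst_le[of "W (x - z)" "W x"] eN by (simp add: W_def dist_real_def)
    qed
    show "norm (grad (conv U \<rho>) x - grad U x) \<le> e" for x
    proof -
      have i: "\<bar>(grad (conv U \<rho>) x - grad U x) $ i\<bar> \<le> e / N" for i
      proof -
        have ci: "continuous_on UNIV (partial_deriv i U)" using U by simp
        have "\<bar>conv \<rho> (partial_deriv i U) x - partial_deriv i U x\<bar> \<le> e / N"
        proof (rule conv_near[OF c\<rho> \<rho>(2-4) ci])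
          show "\<bar>partial_deriv i U (x - z) - partial_deriv i U x\<bar> \<le> e / N" if "norm z < s" for z
            using W[OF that, of x] dist_snd_le[of "W (x - z)" "W x"]
              component_le_norm_cart[of "grad U (x - z) - grad U x" i]
            by (simp add: W_def dist_norm) (simp add: grad_def)
        qed
        then show ?thesis
          by (simp add: comm grad_def partial_deriv_conv[OF c\<rho> \<rho>0 U])
      qed
      have "norm (grad (conv U \<rho>) x - grad U x) \<le> (\<Sum>i\<in>UNIV. \<bar>(grad (conv U \<rho>) x - grad U x) $ i\<bar>)"
        by (rule norm_le_l1_cart)
      also have "\<dots> \<le> (\<Sum>i\<in>(UNIV::'n set). e / N)" by (intro sum_mono i)
      also have "\<dots> = e" using N by (simp add: N_def)
      finally show ?thesis .
    qed
    show "conv U \<rho> x = 0" if "\<And>y. dist x y < \<delta> \<Longrightarrow> U y = 0" for x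
    proof -
      have *: "U y * \<rho> (x - y) = 0" for y
        using that[of y] \<rho>(3)[of "x - y"] s(4) by (cases "dist x y < \<delta>") (auto simp: dist_norm)
      show ?thesis unfolding conv_def * by simp
    qed
  qed
qed

section \<open>Smooth approximation in \<open>C\<^sup>1\<close> on an open set\<close>

lemma grad_sum:
  assumes "\<And>a. a \<in> A \<Longrightarrow> f a differentiable (at x)"
  shows "grad (\<lambda>x. \<Sum>a\<in>A. f a x) x = (\<Sum>a\<in>A. grad (f a) x)"
  by (rule grad_eqI)
    (use assms in \<open>auto simp: inner_sum_left intro!: has_derivative_sum has_derivative_grad\<close>)

text \<open>Turns cutoffs into a partition of unity without dividing by their sum: as soon as one
  \<open>a j\<close> equals 1, the product on the right vanishes and the partial sum is exactly
  1.\<close>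

lemma sum_prod_telescope:
  fixes a :: "nat \<Rightarrow> 'a::comm_ring_1"
  shows "(\<Sum>j\<le>i. a j * (\<Prod>l<j. 1 - a l)) = 1 - (\<Prod>j\<le>i. 1 - a j)"
  by (induction i) (auto simp: algebra_simps lessThan_Suc_atMost)

lemma sum_half_powers_le: "(\<Sum>j\<le>i. e / 2 ^ Suc j) \<le> (e::real)" if "e \<ge> 0"
proof -
  have "(\<Sum>j\<le>i. e / 2 ^ Suc j) = e - e / 2 ^ Suc i"
    by (induction i) (auto simp: field_simps)
  then show ?thesis using that by simp
qed

text \<open>Three radii per centre: the balls of radius r/2 cover, the cutoff will be 1 up to radius
  r and will vanish beyond 2r, still inside G. The gap between r/2 and r leaves room for the spread
  caused by mollification.\<close>

lemma countable_ball_cover: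
  fixes G :: "'a::euclidean_space set"
  assumes "open G" "G \<noteq> {}"
  shows "\<exists>(c :: nat \<Rightarrow> 'a) (r :: nat \<Rightarrow> real). (\<forall>i. r i > 0) \<and> (\<forall>i. cball (c i) (2 * r i) \<subseteq> G)
    \<and> G \<subseteq> (\<Union>i. ball (c i) (r i / 2))"
proof -
  have "\<exists>r>0. cball x (2 * r) \<subseteq> G" if x: "x \<in> G" for x
  proof -
    obtain e where e: "e > 0" "ball x e \<subseteq> G" using assms(1) x by (rule openE) (rule that)
    have "cball x (2 * (e / 3)) \<subseteq> ball x e" using e(1) by (intro cball_subset_ball_iff[THEN iffD2]) simp
    with e have "e / 3 > 0 \<and> cball x (2 * (e / 3)) \<subseteq> G" by (auto simp: subset_iff)
    then show ?thesis by (rule exI)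
  qed
  then obtain r where r: "\<And>x. x \<in> G \<Longrightarrow> r x > 0 \<and> cball x (2 * r x) \<subseteq> G" by metis
  obtain F where F: "F \<subseteq> (\<lambda>x. ball x (r x / 2)) ` G" "countable F"
    "\<Union>F = \<Union>((\<lambda>x. ball x (r x / 2)) ` G)"
    using Lindelof[of "(\<lambda>x. ball x (r x / 2)) ` G"] by (metis (no_types, lifting) imageE open_ball)
  then obtain C where C: "countable C" "C \<subseteq> G" "F = (\<lambda>x. ball x (r x / 2)) ` C"
    using countable_subset_image[of F "\<lambda>x. ball x (r x / 2)" G] by auto
  have cov: "G \<subseteq> (\<Union>x\<in>C. ball x (r x / 2))"
  proof
    fix x assume "x \<in> G"
    then have "x \<in> \<Union>((\<lambda>x. ball x (r x / 2)) ` G)" using r[of x] by (intro UnionI[of "ball x (r x / 2)"]) auto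
    then show "x \<in> (\<Union>x\<in>C. ball x (r x / 2))" unfolding F(3)[symmetric] C(3) .
  qed
  with assms(2) have ne: "C \<noteq> {}" by auto
  show ?thesis
  proof (intro exI[of _ "from_nat_into C"] exI[of _ "\<lambda>i. r (from_nat_into C i)"] conjI allI)
    show "G \<subseteq> (\<Union>i. ball (from_nat_into C i) (r (from_nat_into C i) / 2))"
    proof
      fix x assume "x \<in> G"
      then obtain y where y: "y \<in> C" "x \<in> ball y (r y / 2)" using cov by blast
      obtain i where "from_nat_into C i = y" using from_nat_into_surj[OF C(1) y(1)] by blast
      then show "x \<in> (\<Union>i. ball (from_nat_into C i) (r (from_nat_into C i) / 2))"
        using y(2) by blast
    qed
  qed (use r C(2) from_nat_into[OF ne] in auto)
qed

lemma smooth_approximation_C1: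
  fixes u :: "real^'n::finite \<Rightarrow> real"
  assumes "open G" and u: "C_on (Suc 0) G u" and "e > 0"
  obtains g where "smooth_on G g" "\<And>x. x \<in> G \<Longrightarrow> \<bar>g x - u x\<bar> \<le> e"
    "\<And>x. x \<in> G \<Longrightarrow> norm (grad g x - grad u x) \<le> e"
proof (cases "G = {}")
  case True
  then show ?thesis using that[of "\<lambda>x. 0"] by (simp add: smooth_on_def C_on_const)
next
  case False
  obtain c :: "nat \<Rightarrow> real^'n" and r :: "nat \<Rightarrow> real" where rG: "\<forall>i. r i > 0" "\<forall>i. cball (c i) (2 * r i) \<subseteq> G"
    and cov: "G \<subseteq> (\<Union>i. ball (c i) (r i / 2))"
    using countable_ball_cover[OF assms(1) False] by (elim exE conjE) (rule that)
  have r: "r i > 0" and G: "cball (c i) (2 * r i) \<subseteq> G" for i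
    using rG by (simp_all del: cball_subset_ball_iff)
  define \<psi> where "\<psi> i = cutoff (c i) (r i)" for i
  define \<phi> where "\<phi> i x = \<psi> i x * (\<Prod>j<i. 1 - \<psi> j x)" for i x
  define U where "U i x = (if x \<in> G then \<phi> i x * u x else 0)" for i x
  define B where "B i = ball (c i) (r i / 2)" for i
  have BG: "B i \<subseteq> G" for i
    unfolding B_def by (rule order_trans[OF _ G[of i]]) (use r[of i] in auto)
  have openB: "open (B i)" for i by (simp add: B_def)
  have \<phi>: "C_on k UNIV (\<phi> i)" for k i
    unfolding \<phi>_def \<psi>_def by (intro C_on_mult C_on_prod C_on_diff C_on_const C_on_cutoff open_UNIV)
  have U_far: "U i x = 0" if "dist (c i) x \<ge> 2 * r i" for i x
    using cutoff_eq_0[OF r that] by (simp add: U_def \<phi>_def \<psi>_def)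
  have U_later: "U j x = 0" if "i < j" "dist (c i) x \<le> r i" for i j x
  proof -
    have "(\<Prod>l<j. 1 - \<psi> l x) = 0"
      using that cutoff_eq_1[OF r that(2)] by (auto simp: \<psi>_def)
    then show ?thesis by (simp add: U_def \<phi>_def)
  qed
  \<comment> \<open>The piece is \<open>C^1\<close> on G by the product rule and zero off a closed
    ball contained in G; these two open sets cover the whole space.\<close>
  have UC1: "C_on (Suc 0) UNIV (U i)" for i
  proof -
    have "C_on (Suc 0) G (\<lambda>x. \<phi> i x * u x)"
      by (intro C_on_mult assms(1) u C_on_subset[OF \<phi> subset_UNIV])
    then have "C_on (Suc 0) G (U i)"
      by (rule C_on_cong[OF assms(1), rotated]) (simp add: U_def)
    moreover have "C_on (Suc 0) (- cball (c i) (2 * r i)) (U i)"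
      by (rule C_on_cong[OF _ _ C_on_const[of _ _ 0]]) (auto simp: U_far open_Compl)
    moreover have "G \<union> - cball (c i) (2 * r i) = UNIV" using G[of i] by auto
    ultimately show ?thesis
      using C_on_Un[of G "- cball (c i) (2 * r i)" "Suc 0" "U i"] assms(1) by (simp add: open_Compl del: C_on.simps)
  qed
  \<comment> \<open>The tolerances sum to at most \<open>e\<close>. The spread is limited by half of
    every radius up to index \<open>i\<close>, so the mollified piece still vanishes on each earlier
    ball \<open>B j\<close>: the unmollified one vanishes up to radius \<open>r j\<close>, twice the
    radius of \<open>B j\<close>.\<close>
  have "\<exists>p. smooth_on UNIV p \<and> (\<forall>x. \<bar>p x - U i x\<bar> \<le> e / 2 ^ Suc i)
      \<and> (\<forall>x. norm (grad p x - grad (U i) x) \<le> e / 2 ^ Suc i)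
      \<and> (\<forall>x. (\<forall>y. dist x y < Min (r ` {..i}) / 2 \<longrightarrow> U i y = 0) \<longrightarrow> p x = 0)" for i
  proof (rule mollify[OF UC1[of i], of "norm (c i) + 2 * r i" "e / 2 ^ Suc i" "Min (r ` {..i}) / 2"])
    show "U i x = 0" if "norm x > norm (c i) + 2 * r i" for x
      using that norm_triangle_ineq2[of x "c i"] by (intro U_far) (simp add: dist_norm norm_minus_commute)
  qed (use \<open>e > 0\<close> r in auto)
  then obtain p where p: "\<And>i. smooth_on UNIV (p i)" "\<And>i x. \<bar>p i x - U i x\<bar> \<le> e / 2 ^ Suc i"
    "\<And>i x. norm (grad (p i) x - grad (U i) x) \<le> e / 2 ^ Suc i"
    "\<And>i x. (\<And>y. dist x y < Min (r ` {..i}) / 2 \<Longrightarrow> U i y = 0) \<Longrightarrow> p i x = 0"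
    by metis
  have p0: "p j x = 0" if "i < j" "x \<in> B i" for i j x
  proof (rule p(4))
    fix y assume y: "dist x y < Min (r ` {..j}) / 2"
    have "Min (r ` {..j}) \<le> r i" using that by auto
    then have "dist x y < r i / 2" using y by linarith
    moreover have "dist (c i) x < r i / 2" using that(2) by (simp add: B_def)
    ultimately have "dist (c i) y \<le> r i"
      using dist_triangle[of "c i" y x] by linarith
    then show "U j y = 0" using that(1) U_later by blast
  qed
  \<comment> \<open>On \<open>B i\<close> the cutoff \<open>\<psi> i\<close> is 1, so the
    telescoping sum stops: the pieces up to \<open>i\<close> already add up to
    \<open>u\<close>.\<close>
  have uU: "u x = (\<Sum>j\<le>i. U j x)" if "x \<in> B i" for i x
  proof -
    have "\<psi> i x = 1" using that r[of i] by (simp add: \<psi>_def B_def cutoff_eq_1)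
    then have "(\<Prod>j\<le>i. 1 - \<psi> j x) = 0" by auto
    then have "(\<Sum>j\<le>i. \<phi> j x) = 1" by (simp add: \<phi>_def sum_prod_telescope)
    moreover have "x \<in> G" using BG that by blast
    ultimately show ?thesis by (simp add: U_def flip: sum_distrib_right)
  qed
  define g where "g x = (\<Sum>j. p j x)" for x
  have g: "g x = (\<Sum>j\<le>i. p j x)" if "x \<in> B i" for i x
    unfolding g_def by (rule suminf_finite) (use p0 that in \<open>auto simp: not_le\<close>)
  have pC: "C_on k (B i) (p j)" for i j k
    by (rule C_on_subset[OF p(1)[unfolded smooth_on_def, rule_format] subset_UNIV])
  have "C_on k (B i) g" for i k
    by (rule C_on_cong[OF openB, where f="\<lambda>x. \<Sum>j\<le>i. p j x"]) (auto simp: g intro!: C_on_sum openB pC)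
  then have "C_on k (\<Union>(range B)) g" for k
    by (intro C_on_Union) (auto simp: openB)
  then have "C_on k G g" for k
    by (rule C_on_subset) (use cov in \<open>simp add: B_def\<close>)
  moreover have "\<bar>g x - u x\<bar> \<le> e \<and> norm (grad g x - grad u x) \<le> e" if x: "x \<in> G" for x
  proof -
    obtain i where i: "x \<in> B i" using cov x unfolding B_def by blast
    have "g x - u x = (\<Sum>j\<le>i. p j x - U j x)"
      by (simp add: g[OF i] uU[OF i] sum_subtractf)
    also have "\<bar>\<dots>\<bar> \<le> (\<Sum>j\<le>i. e / 2 ^ Suc j)"
      by (rule sum_abs[THEN order_trans]) (intro sum_mono p(2))
    also have "\<dots> \<le> e" using \<open>e > 0\<close> by (intro sum_half_powers_le) auto
    finally have 1: "\<bar>g x - u x\<bar> \<le> e" .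
    have "grad g x = grad (\<lambda>x. \<Sum>j\<le>i. p j x) x"
      by (rule grad_cong[OF openB i]) (rule g)
    also have "\<dots> = (\<Sum>j\<le>i. grad (p j) x)"
      using pC[of "Suc 0" i] i by (intro grad_sum) auto
    finally have "grad g x = (\<Sum>j\<le>i. grad (p j) x)" .
    moreover have "grad u x = grad (\<lambda>x. \<Sum>j\<le>i. U j x) x"
      by (rule grad_cong[OF openB i]) (rule uU)
    moreover have "\<dots> = (\<Sum>j\<le>i. grad (U j) x)"
      using UC1 by (intro grad_sum) auto
    ultimately have "grad g x - grad u x = (\<Sum>j\<le>i. grad (p j) x - grad (U j) x)"
      by (simp add: sum_subtractf)
    also have "norm \<dots> \<le> (\<Sum>j\<le>i. e / 2 ^ Suc j)"
      by (rule norm_sum[THEN order_trans]) (intro sum_mono p(3))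
    also have "\<dots> \<le> e" using \<open>e > 0\<close> by (intro sum_half_powers_le) auto
    finally show ?thesis using 1 by simp
  qed
  ultimately show ?thesis using that[of g] by (auto simp: smooth_on_def)
qed

section \<open>The logarithmic Sobolev inequality for \<open>C\<^sup>1\<close> functions\<close>

lemma C_on_compose_real:
  assumes "open G" and u: "C_on (Suc 0) G u"
    and \<theta>: "\<And>x. x \<in> G \<Longrightarrow> (\<theta> has_real_derivative \<theta>' (u x)) (at (u x))"
    and cont: "continuous_on (u ` G) \<theta>'"
  shows "C_on (Suc 0) G (\<lambda>x. \<theta> (u x))"
    and "\<And>x. x \<in> G \<Longrightarrow> grad (\<lambda>x. \<theta> (u x)) x = \<theta>' (u x) *\<^sub>R grad u x"
proof -
  have D: "((\<lambda>x. \<theta> (u x)) has_derivative (\<lambda>h. (\<theta>' (u x) *\<^sub>R grad u x) \<bullet> h)) (at x)" if "x \<in> G" for x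
    using has_derivative_compose[OF C_on_Suc_derivative[OF u that]
        \<theta>[OF that, unfolded has_field_derivative_def]] by simp
  then show "grad (\<lambda>x. \<theta> (u x)) x = \<theta>' (u x) *\<^sub>R grad u x" if "x \<in> G" for x
    using that by (intro grad_eqI) auto
  have "continuous_on G (\<lambda>x. \<theta>' (u x))"
    by (rule continuous_on_compose2[OF cont]) (auto intro: C_on_imp_continuous[OF u])
  moreover have "continuous_on G (grad u)" by (rule continuous_on_grad[OF u])
  ultimately have "C_on 0 G (\<lambda>x. (\<theta>' (u x) *\<^sub>R grad u x) \<bullet> axis i 1)" for i
    by (auto intro!: continuous_intros)
  then show "C_on (Suc 0) G (\<lambda>x. \<theta> (u x))"
    using D by (intro C_on_SucI[OF \<open>open G\<close>]) auto
qed

text \<open>Dominates the entropy integrand: with s a square, it bounds s ln s by a polynomial, also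
  near and at 0.\<close>

lemma abs_mult_ln_le: "\<bar>s * ln s\<bar> \<le> 1 + s\<^sup>2" if "s \<ge> 0" for s :: real
proof (cases "s = 0")
  case False
  with that have s: "s > 0" by simp
  have "s * ln s \<le> s * (s - 1)"
    using s ln_le_minus_one[OF s] by (intro mult_left_mono) auto
  moreover have "ln (inverse s) \<le> inverse s - 1" using s by (intro ln_le_minus_one) simp
  then have "s * (1 - inverse s) \<le> s * ln s"
    using s by (intro mult_left_mono) (auto simp: ln_inverse)
  then have "s - 1 \<le> s * ln s" using s by (simp add: algebra_simps)
  moreover have "s * (s - 1) \<le> 1 + s\<^sup>2" using s by (simp add: algebra_simps power2_eq_square)
  moreover have "- (s - 1) \<le> 1 + s\<^sup>2" using s zero_le_power2[of s] by linarith
  ultimately show ?thesis by (intro abs_leI) linarith+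
qed simp

locale log_Sobolev_space = prob_space M for M :: "(real^'n::finite) measure" +
  fixes G :: "(real^'n) set" and c :: real
  assumes open_G: "open G" and sets_M: "sets M = sets (restrict_space borel G)"
    and c_pos: "c > 0" and lsi: "log_Sobolev G M c"
begin

lemma space_M [simp]: "space M = G"
  using sets_eq_imp_space_eq[OF sets_M] by (simp add: space_restrict_space)

lemma prob_G [simp]: "prob G = 1"
  using prob_space by simp

lemma measurable_continuous: "continuous_on G f \<Longrightarrow> f \<in> borel_measurable M"
  using borel_measurable_continuous_on_restrict[of G f] measurable_cong_sets[OF sets_M refl] by blast

lemma integrable_bounded:
  fixes h :: "real^'n \<Rightarrow> real"
  assumes "h \<in> borel_measurable M" "\<And>x. x \<in> G \<Longrightarrow> \<bar>h x\<bar> \<le> B"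
  shows "integrable M h"
  by (rule integrable_const_bound[of _ B]) (use assms in auto)

text \<open>The integrable majorant \<open>h\<close> makes the energy finite, so the inequality
  between extended numbers becomes one between reals.\<close>

lemma entropy_bound_smooth:
  assumes g: "smooth_on G g" and bnd: "\<And>x. x \<in> G \<Longrightarrow> \<bar>g x\<bar> \<le> B"
    and h: "\<And>x. x \<in> G \<Longrightarrow> (norm (grad g x))\<^sup>2 \<le> h x" "integrable M h"
  shows "Ent M (\<lambda>x. (g x)\<^sup>2) \<le> 2 * c * (\<integral>x. h x \<partial>M)"
proof -
  have hnn: "h x \<ge> 0" if "x \<in> G" for x using h(1)[OF that] by (meson order_trans zero_le_power2)
  have "bounded (g ` G)" unfolding bounded_iff using bnd by auto
  then have "ennreal (Ent M (\<lambda>x. (g x)\<^sup>2)) \<le> ennreal (2 * c) * (\<integral>\<^sup>+x. ennreal ((norm (grad g x))\<^sup>2) \<partial>M)"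
    using lsi g unfolding log_Sobolev_def by blast
  also have "\<dots> \<le> ennreal (2 * c) * (\<integral>\<^sup>+x. ennreal (h x) \<partial>M)"
    by (intro mult_left_mono nn_integral_mono ennreal_leI) (use h in auto)
  also have "(\<integral>\<^sup>+x. ennreal (h x) \<partial>M) = ennreal (\<integral>x. h x \<partial>M)"
    by (rule nn_integral_eq_integral[OF h(2)]) (use hnn in auto)
  also have "ennreal (2 * c) * \<dots> = ennreal (2 * c * (\<integral>x. h x \<partial>M))"
    using c_pos by (simp add: ennreal_mult')
  finally show ?thesis
    using c_pos hnn by (subst (asm) ennreal_le_iff) (auto intro!: mult_nonneg_nonneg Bochner_Integration.integral_nonneg)
qed

text \<open>Limit along uniformly close smooth functions. They are uniformly bounded, and positivity
  of \<open>v\<close> makes the logarithm continuous at the limit values, so the entropies converge;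
  the energies are controlled through the majorant \<open>w\<close>.\<close>

lemma log_Sobolev_C1:
  assumes v: "C_on (Suc 0) G v" and bnd: "\<And>x. x \<in> G \<Longrightarrow> 0 < v x" "\<And>x. x \<in> G \<Longrightarrow> v x \<le> B"
    and w: "\<And>x. x \<in> G \<Longrightarrow> norm (grad v x) \<le> w x" "integrable M (\<lambda>x. (w x)\<^sup>2)"
  shows "Ent M (\<lambda>x. (v x)\<^sup>2) \<le> 2 * c * (\<integral>x. (w x)\<^sup>2 \<partial>M)"
proof -
  define e where "e n = 1 / real (Suc n)" for n
  have e: "e n > 0" "e n \<le> 1" for n by (auto simp: e_def)
  have e0: "e \<longlonglongrightarrow> 0" unfolding e_def by (rule LIMSEQ_Suc) (rule lim_1_over_n)
  have "\<exists>g. smooth_on G g \<and> (\<forall>x\<in>G. \<bar>g x - v x\<bar> \<le> e n) \<and> (\<forall>x\<in>G. norm (grad g x - grad v x) \<le> e n)" for n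
    by (rule smooth_approximation_C1[OF open_G v e(1)[of n]]) auto
  then obtain g where g: "\<And>n. smooth_on G (g n)" "\<And>n x. x \<in> G \<Longrightarrow> \<bar>g n x - v x\<bar> \<le> e n"
    "\<And>n x. x \<in> G \<Longrightarrow> norm (grad (g n) x - grad v x) \<le> e n"
    by metis
  define W where "W = (\<integral>x. (w x)\<^sup>2 \<partial>M)"
  have gB: "\<bar>g n x\<bar> \<le> \<bar>B\<bar> + 1" if "x \<in> G" for n x
    using g(2)[OF that, of n] bnd[OF that] e[of n] by linarith
  have glim: "(\<lambda>n. g n x) \<longlonglongrightarrow> v x" if "x \<in> G" for x
    by (rule LIM_zero_cancel, rule Lim_null_comparison[OF always_eventually e0]) (use g(2)[OF that] in auto)
  have meas: "g n \<in> borel_measurable M" "v \<in> borel_measurable M" for n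
    using g(1)[of n] C_on_imp_continuous[OF v] unfolding smooth_on_def
    by (auto intro!: measurable_continuous intro: C_on_imp_continuous)
  have bound: "Ent M (\<lambda>x. (g n x)\<^sup>2) \<le> 2 * c * ((1 + e n) * W + (e n + (e n)\<^sup>2))" for n
  proof -
    have "Ent M (\<lambda>x. (g n x)\<^sup>2) \<le> 2 * c * (\<integral>x. (1 + e n) * (w x)\<^sup>2 + (e n + (e n)\<^sup>2) \<partial>M)"
    proof (rule entropy_bound_smooth[OF g(1) gB])
      fix x assume x: "x \<in> G"
      have "norm (grad (g n) x) \<le> w x + e n"
        using g(3)[OF x, of n] w(1)[OF x] norm_triangle_sub[of "grad (g n) x" "grad v x"] by linarith
      then have "(norm (grad (g n) x))\<^sup>2 \<le> (w x + e n)\<^sup>2" by (intro power_mono) auto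
      also have "\<dots> \<le> (1 + e n) * (w x)\<^sup>2 + (e n + (e n)\<^sup>2)"
      proof -
        \<comment> \<open>The cross term 2 e w is at most \<open>e (w^2 + 1)\<close>, so the
          integral of \<open>w^2\<close> alone controls the energy.\<close>
        have "0 \<le> e n * (w x - 1)\<^sup>2" using e[of n] by simp
        then show ?thesis by (simp add: power2_eq_square algebra_simps)
      qed
      finally show "(norm (grad (g n) x))\<^sup>2 \<le> (1 + e n) * (w x)\<^sup>2 + (e n + (e n)\<^sup>2)" .
    qed (use w in auto)
    also have "\<dots> = 2 * c * ((1 + e n) * W + (e n + (e n)\<^sup>2))"
      using w(2) by (simp add: W_def prob_G)
    finally show ?thesis .
  qed
  have "(\<lambda>n. Ent M (\<lambda>x. (g n x)\<^sup>2)) \<longlonglongrightarrow> Ent M (\<lambda>x. (v x)\<^sup>2)"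
  proof -
    have sq: "(g n x)\<^sup>2 \<le> (\<bar>B\<bar> + 1)\<^sup>2" if "x \<in> G" for n x
      using gB[OF that, of n] by (simp add: abs_le_square_iff[symmetric])
    have 1: "(\<lambda>n. \<integral>x. (g n x)\<^sup>2 \<partial>M) \<longlonglongrightarrow> (\<integral>x. (v x)\<^sup>2 \<partial>M)"
      by (rule integral_dominated_convergence[where w="\<lambda>_. (\<bar>B\<bar> + 1)\<^sup>2"])
        (use meas sq glim in \<open>auto intro!: tendsto_intros\<close>)
    have 2: "(\<lambda>n. \<integral>x. (g n x)\<^sup>2 * ln ((g n x)\<^sup>2) \<partial>M) \<longlonglongrightarrow> (\<integral>x. (v x)\<^sup>2 * ln ((v x)\<^sup>2) \<partial>M)"
    proof (rule integral_dominated_convergence[where w="\<lambda>_. 1 + ((\<bar>B\<bar> + 1)\<^sup>2)\<^sup>2"])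
      show "AE x in M. (\<lambda>n. (g n x)\<^sup>2 * ln ((g n x)\<^sup>2)) \<longlonglongrightarrow> (v x)\<^sup>2 * ln ((v x)\<^sup>2)"
      proof (rule AE_I2)
        fix x assume "x \<in> space M"
        then have "x \<in> G" by simp
        then show "(\<lambda>n. (g n x)\<^sup>2 * ln ((g n x)\<^sup>2)) \<longlonglongrightarrow> (v x)\<^sup>2 * ln ((v x)\<^sup>2)"
          using bnd(1) by (intro tendsto_intros glim) (auto simp: less_le)
      qed
      show "AE x in M. norm ((g n x)\<^sup>2 * ln ((g n x)\<^sup>2)) \<le> 1 + ((\<bar>B\<bar> + 1)\<^sup>2)\<^sup>2" for n
      proof (rule AE_I2)
        fix x assume "x \<in> space M"
        then have x: "x \<in> G" by simp
        have "((g n x)\<^sup>2)\<^sup>2 \<le> ((\<bar>B\<bar> + 1)\<^sup>2)\<^sup>2" by (rule power_mono[OF sq[OF x]]) simp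
        then show "norm ((g n x)\<^sup>2 * ln ((g n x)\<^sup>2)) \<le> 1 + ((\<bar>B\<bar> + 1)\<^sup>2)\<^sup>2"
          using abs_mult_ln_le[of "(g n x)\<^sup>2"] by simp
      qed
    qed (use meas in auto)
    have "integrable M (\<lambda>x. (v x)\<^sup>2)"
      by (rule integrable_bounded[of _ "B\<^sup>2"]) (use meas bnd in \<open>auto intro!: power_mono intro: less_imp_le\<close>)
    then have "0 < (\<integral>x. (v x)\<^sup>2 \<partial>M)"
    proof (rule expectation_greater, intro AE_I2)
      fix x assume "x \<in> space M"
      then have "0 < v x" using bnd(1) by simp
      then show "0 < (v x)\<^sup>2" by simp
    qed
    then show ?thesis unfolding Ent_def by (intro tendsto_intros 1 2) simp
  qed
  moreover have "(\<lambda>n. 2 * c * ((1 + e n) * W + (e n + (e n)\<^sup>2))) \<longlonglongrightarrow> 2 * c * ((1 + 0) * W + (0 + 0\<^sup>2))"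
    by (intro tendsto_intros e0)
  ultimately have "Ent M (\<lambda>x. (v x)\<^sup>2) \<le> 2 * c * ((1 + 0) * W + (0 + 0\<^sup>2))"
    by (rule LIMSEQ_le) (use bound in auto)
  then show ?thesis by (simp add: W_def)
qed

end

section \<open>Derivatives and comparison of moments\<close>

text \<open>Two-sided positive bounds on \<open>u\<close> make \<open>ln (u x)\<close> bounded, so
  the second-order remainder of the exponential is \<open>O(h^2)\<close> uniformly in x and can be
  integrated.\<close>

lemma has_derivative_moment:
  fixes u :: "'a \<Rightarrow> real"
  assumes "prob_space M" and [measurable]: "u \<in> borel_measurable M"
    and a: "a > 0" "\<And>x. x \<in> space M \<Longrightarrow> a \<le> u x" "\<And>x. x \<in> space M \<Longrightarrow> u x \<le> b"
  shows "((\<lambda>q. \<integral>x. u x powr q \<partial>M) has_real_derivative (\<integral>x. u x powr q * ln (u x) \<partial>M)) (at q)"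
proof -
  interpret prob_space M by fact
  define L where "L = \<bar>ln a\<bar> + \<bar>ln b\<bar>"
  have L: "\<bar>ln (u x)\<bar> \<le> L" if "x \<in> space M" for x
  proof -
    have "ln a \<le> ln (u x)" "ln (u x) \<le> ln b" using a(1) a(2,3)[OF that] by auto
    then show ?thesis unfolding L_def by linarith
  qed
  have L0: "L \<ge> 0" by (simp add: L_def)
  have pos: "u x > 0" if "x \<in> space M" for x using a(1) a(2)[OF that] by linarith
  have pb: "u x powr r \<le> exp (\<bar>r\<bar> * L)" if "x \<in> space M" for x r
  proof -
    have "r * ln (u x) \<le> \<bar>r\<bar> * L"
      using mult_mono[OF order_refl[of "\<bar>r\<bar>"] L[OF that]] abs_ge_self[of "r * ln (u x)"]
      by (simp add: abs_mult)
    then show ?thesis using pos[OF that] by (simp add: powr_def)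
  qed
  have int1: "integrable M (\<lambda>x. u x powr r)" for r
    by (rule integrable_const_bound[of _ "exp (\<bar>r\<bar> * L)"]) (use pb in auto)
  have int2: "integrable M (\<lambda>x. u x powr r * ln (u x))" for r
    by (rule integrable_const_bound[of _ "exp (\<bar>r\<bar> * L) * L"])
      (use pb L in \<open>auto simp: abs_mult intro!: AE_I2 mult_mono\<close>)
  \<comment> \<open>The factors bound \<open>u x powr q\<close>, the exponential in the Taylor
    remainder, and the square of \<open>ln (u x)\<close>; the factor 1/2 of the remainder is given
    away.\<close>
  define K where "K = exp (\<bar>q\<bar> * L) * (exp L * L\<^sup>2)"
  define I where "I q = (\<integral>x. u x powr q \<partial>M)" for q
  define D where "D = (\<integral>x. u x powr q * ln (u x) \<partial>M)"
  have est: "\<bar>u x powr (q + h) - u x powr q - h * (u x powr q * ln (u x))\<bar> \<le> K * h\<^sup>2"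
    if x: "x \<in> space M" and h: "\<bar>h\<bar> \<le> 1" for x h
  proof -
    define y where "y = h * ln (u x)"
    have y: "\<bar>y\<bar> \<le> \<bar>h\<bar> * L" unfolding y_def abs_mult using L[OF x] by (intro mult_left_mono) auto
    then have yL: "\<bar>y\<bar> \<le> L" using mult_right_mono[OF h L0] by linarith
    obtain t where t: "\<bar>t\<bar> \<le> \<bar>y\<bar>" "exp y = (\<Sum>m<2. (y ^ m) / fact m) + (exp t / fact 2) * y ^ 2"
      using Maclaurin_exp_le[of y 2] by blast
    have "u x powr (q + h) - u x powr q - h * (u x powr q * ln (u x)) = u x powr q * (exp y - 1 - y)"
      using pos[OF x] by (simp add: powr_def y_def exp_add algebra_simps)
    also have "exp y - 1 - y = exp t / 2 * y\<^sup>2" using t(2) by (simp add: numeral_2_eq_2)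
    finally have "u x powr (q + h) - u x powr q - h * (u x powr q * ln (u x)) = u x powr q * (exp t / 2 * y\<^sup>2)" .
    moreover have "0 \<le> u x powr q * (exp t / 2 * y\<^sup>2)" by simp
    ultimately have "\<bar>u x powr (q + h) - u x powr q - h * (u x powr q * ln (u x))\<bar> = u x powr q * (exp t / 2 * y\<^sup>2)"
      by (simp only: abs_of_nonneg)
    also have "\<dots> \<le> exp (\<bar>q\<bar> * L) * (exp L * (\<bar>h\<bar> * L)\<^sup>2)"
    proof (intro mult_mono pb x)
      have "exp t \<le> exp L" using t(1) yL by simp
      then show "exp t / 2 \<le> exp L" using exp_ge_zero[of t] by linarith
      show "y\<^sup>2 \<le> (\<bar>h\<bar> * L)\<^sup>2" using power_mono[OF y, of 2] by simp
    qed auto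
    also have "\<dots> = K * h\<^sup>2" by (simp add: K_def power_mult_distrib)
    finally show ?thesis .
  qed
  have "\<bar>(I (q + h) - I q) / h - D\<bar> \<le> K * \<bar>h\<bar>" if h: "h \<noteq> 0" "\<bar>h\<bar> \<le> 1" for h
  proof -
    define E where "E x = u x powr (q + h) - u x powr q - h * (u x powr q * ln (u x))" for x
    have intE: "integrable M E" unfolding E_def using int1 int2 by auto
    have eqE: "I (q + h) - I q - h * D = (\<integral>x. E x \<partial>M)"
      using int1 int2 by (simp add: I_def D_def E_def)
    have "\<bar>\<integral>x. E x \<partial>M\<bar> \<le> (\<integral>x. \<bar>E x\<bar> \<partial>M)"
      by (rule integral_abs_bound)
    also have "\<dots> \<le> (\<integral>x. K * h\<^sup>2 \<partial>M)"
      by (rule integral_mono) (use intE est[OF _ h(2), folded E_def] in auto)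
    finally have "\<bar>I (q + h) - I q - h * D\<bar> \<le> K * h\<^sup>2" by (simp add: prob_space eqE)
    moreover have "(I (q + h) - I q) / h - D = (I (q + h) - I q - h * D) / h"
      using h(1) by (simp add: field_simps)
    ultimately have "\<bar>(I (q + h) - I q) / h - D\<bar> \<le> K * h\<^sup>2 / \<bar>h\<bar>"
      by (simp add: abs_divide divide_right_mono)
    also have "\<dots> = K * \<bar>h\<bar>" using h(1) by (simp add: power2_eq_square abs_if)
    finally show ?thesis .
  qed
  then have "\<forall>\<^sub>F h in at 0. norm ((I (q + h) - I q) / h - D) \<le> K * \<bar>h\<bar>"
    unfolding eventually_at by (intro exI[of _ 1]) (auto simp: dist_real_def)
  moreover have "((\<lambda>h. K * \<bar>h\<bar>) \<longlongrightarrow> 0) (at 0)"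
    by (auto intro!: tendsto_eq_intros)
  ultimately have "((\<lambda>h. (I (q + h) - I q) / h - D) \<longlongrightarrow> 0) (at 0)"
    by (rule Lim_null_comparison)
  then have "((\<lambda>h. (I (q + h) - I q) / h) \<longlongrightarrow> D) (at 0)" by (rule LIM_zero_cancel)
  then show ?thesis unfolding DERIV_def I_def D_def .
qed

text \<open>Weighted Young inequality, applied after dividing \<open>f\<close> and \<open>g\<close>
  by their integrals.\<close>

lemma Holder_interpolation:
  fixes f g :: "'a \<Rightarrow> real"
  assumes f: "integrable M f" "\<And>x. x \<in> space M \<Longrightarrow> f x \<ge> 0"
    and g: "integrable M g" "\<And>x. x \<in> space M \<Longrightarrow> g x \<ge> 0" and "0 < \<theta>" "\<theta> < 1"
  shows "integrable M (\<lambda>x. f x powr (1 - \<theta>) * g x powr \<theta>)"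
    and "(\<integral>x. f x powr (1 - \<theta>) * g x powr \<theta> \<partial>M) \<le> (\<integral>x. f x \<partial>M) powr (1 - \<theta>) * (\<integral>x. g x \<partial>M) powr \<theta>"
proof -
  have [measurable]: "f \<in> borel_measurable M" "g \<in> borel_measurable M" using f g by auto
  have young: "s powr (1 - \<theta>) * t powr \<theta> \<le> (1 - \<theta>) * s + \<theta> * t" if "s \<ge> 0" "t \<ge> 0" for s t :: real
    using Youngs_inequality_0[of "1 - \<theta>" \<theta> s t] assms(5,6) that by (cases "s = 0 \<or> t = 0") auto
  show int: "integrable M (\<lambda>x. f x powr (1 - \<theta>) * g x powr \<theta>)"
  proof (rule Bochner_Integration.integrable_bound)
    show "integrable M (\<lambda>x. (1 - \<theta>) * f x + \<theta> * g x)" using f g by auto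
    show "AE x in M. norm (f x powr (1 - \<theta>) * g x powr \<theta>) \<le> norm ((1 - \<theta>) * f x + \<theta> * g x)"
    proof (rule AE_I2)
      fix x assume "x \<in> space M"
      then show "norm (f x powr (1 - \<theta>) * g x powr \<theta>) \<le> norm ((1 - \<theta>) * f x + \<theta> * g x)"
        using young[of "f x" "g x"] f(2) g(2) by (auto simp: abs_mult)
    qed
  qed measurable
  define A B where "A = (\<integral>x. f x \<partial>M)" and "B = (\<integral>x. g x \<partial>M)"
  have AB: "A \<ge> 0" "B \<ge> 0" unfolding A_def B_def using f g by (auto intro: Bochner_Integration.integral_nonneg)
  show "(\<integral>x. f x powr (1 - \<theta>) * g x powr \<theta> \<partial>M) \<le> (\<integral>x. f x \<partial>M) powr (1 - \<theta>) * (\<integral>x. g x \<partial>M) powr \<theta>"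
  proof (cases "A = 0 \<or> B = 0")
    case True
    \<comment> \<open>With a vanishing integral this normalisation is impossible, but then one
      factor, and hence the product, is zero almost everywhere.\<close>
    then have "AE x in M. f x = 0 \<or> g x = 0"
      using integral_nonneg_eq_0_iff_AE[OF f(1)] integral_nonneg_eq_0_iff_AE[OF g(1)] f(2) g(2)
      unfolding A_def B_def by (auto elim: eventually_mono)
    then have "(\<integral>x. f x powr (1 - \<theta>) * g x powr \<theta> \<partial>M) = (\<integral>x. 0 \<partial>M)"
      by (intro integral_cong_AE) (auto elim!: eventually_mono)
    then show ?thesis by simp
  next
    case False
    with AB have AB: "A > 0" "B > 0" by auto
    have "(\<integral>x. f x powr (1 - \<theta>) * g x powr \<theta> \<partial>M)
        \<le> (\<integral>x. A powr (1 - \<theta>) * B powr \<theta> * ((1 - \<theta>) * (f x / A) + \<theta> * (g x / B)) \<partial>M)"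
    proof (rule integral_mono[OF int])
      fix x assume x: "x \<in> space M"
      have "f x powr (1 - \<theta>) * g x powr \<theta>
          = A powr (1 - \<theta>) * B powr \<theta> * ((f x / A) powr (1 - \<theta>) * (g x / B) powr \<theta>)"
        using AB f(2)[OF x] g(2)[OF x] by (simp add: powr_divide)
      also have "\<dots> \<le> A powr (1 - \<theta>) * B powr \<theta> * ((1 - \<theta>) * (f x / A) + \<theta> * (g x / B))"
        using AB f(2)[OF x] g(2)[OF x] by (intro mult_left_mono young) auto
      finally show "f x powr (1 - \<theta>) * g x powr \<theta>
          \<le> A powr (1 - \<theta>) * B powr \<theta> * ((1 - \<theta>) * (f x / A) + \<theta> * (g x / B))" .
    qed (use f g in auto)
    also have "\<dots> = A powr (1 - \<theta>) * B powr \<theta> * ((1 - \<theta>) * (A / A) + \<theta> * (B / B))"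
      using f g by (simp add: A_def B_def)
    also have "\<dots> = A powr (1 - \<theta>) * B powr \<theta>" using AB by simp
    finally show ?thesis by (simp add: A_def B_def)
  qed
qed

text \<open>Holder's inequality against the constant 1 with weight q/p. The exponents 2/q and 2/p
  give squared norms, the form used in all moment estimates.\<close>

lemma (in prob_space) moment_mono:
  fixes w :: "'a \<Rightarrow> real"
  assumes [measurable]: "w \<in> borel_measurable M" and nn: "\<And>x. x \<in> space M \<Longrightarrow> w x \<ge> 0"
    and int: "integrable M (\<lambda>x. w x powr p)" and "0 < q" "q \<le> p"
  shows "integrable M (\<lambda>x. w x powr q)"
    and "(\<integral>x. w x powr q \<partial>M) powr (2 / q) \<le> (\<integral>x. w x powr p \<partial>M) powr (2 / p)"
proof -
  have "integrable M (\<lambda>x. w x powr q) \<and>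
      (\<integral>x. w x powr q \<partial>M) powr (2 / q) \<le> (\<integral>x. w x powr p \<partial>M) powr (2 / p)"
  proof (cases "q = p")
    case False
    with assms have qp: "0 < q / p" "q / p < 1" "p > 0" by auto
    have eq: "1 powr (1 - q / p) * (w x powr p) powr (q / p) = w x powr q" for x
      using qp by (simp add: powr_powr)
    note H = Holder_interpolation[OF _ _ int _ qp(1,2), of "\<lambda>_. 1", unfolded eq]
    have "(\<integral>x. w x powr q \<partial>M) \<le> (\<integral>x. w x powr p \<partial>M) powr (q / p)"
      using H(2) by (simp add: prob_space)
    then have "(\<integral>x. w x powr q \<partial>M) powr (2 / q) \<le> ((\<integral>x. w x powr p \<partial>M) powr (q / p)) powr (2 / q)"
      using \<open>0 < q\<close> by (intro powr_mono2) (auto intro: Bochner_Integration.integral_nonneg)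
    also have "\<dots> = (\<integral>x. w x powr p \<partial>M) powr (2 / p)"
      using \<open>0 < q\<close> qp by (simp add: powr_powr)
    finally show ?thesis using H(1) by simp
  qed (use int in auto)
  then show "integrable M (\<lambda>x. w x powr q)"
    and "(\<integral>x. w x powr q \<partial>M) powr (2 / q) \<le> (\<integral>x. w x powr p \<partial>M) powr (2 / p)" by auto
qed

section \<open>Growth of moments\<close>

text \<open>Integrability of the limit is a conclusion here: finite moments of an unbounded function
  are obtained in this way from those of its truncations.\<close>

lemma Fatou_bound:
  fixes f :: "nat \<Rightarrow> 'a \<Rightarrow> real"
  assumes f: "\<And>n. integrable M (f n)" "\<And>n x. x \<in> space M \<Longrightarrow> f n x \<ge> 0"
    and lim: "\<And>x. x \<in> space M \<Longrightarrow> (\<lambda>n. f n x) \<longlonglongrightarrow> g x"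
    and bnd: "\<And>n. (\<integral>x. f n x \<partial>M) \<le> A n" "A \<longlonglongrightarrow> a"
  shows "integrable M g" "(\<integral>x. g x \<partial>M) \<le> a"
proof -
  have [measurable]: "f n \<in> borel_measurable M" for n using f(1) by auto
  have [measurable]: "g \<in> borel_measurable M"
    by (rule borel_measurable_LIMSEQ_real[OF lim]) auto
  have gnn: "g x \<ge> 0" if "x \<in> space M" for x
    by (rule LIMSEQ_le_const[OF lim[OF that]]) (use f(2)[OF that] in auto)
  have a: "a \<ge> 0"
  proof (rule LIMSEQ_le_const[OF bnd(2)], intro exI allI impI)
    fix n
    show "0 \<le> A n"
      using f(2) bnd(1)[of n] by (meson Bochner_Integration.integral_nonneg order_trans)
  qed
  have "(\<integral>\<^sup>+x. ennreal (g x) \<partial>M) = (\<integral>\<^sup>+x. liminf (\<lambda>n. ennreal (f n x)) \<partial>M)"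
    by (intro nn_integral_cong) (use lim in \<open>auto intro!: lim_imp_Liminf[symmetric] tendsto_ennrealI\<close>)
  also have "\<dots> \<le> liminf (\<lambda>n. \<integral>\<^sup>+x. ennreal (f n x) \<partial>M)"
    by (rule nn_integral_liminf) auto
  also have "\<dots> \<le> liminf (\<lambda>n. ennreal (A n))"
  proof (intro Liminf_mono always_eventually allI)
    fix n
    have "(\<integral>\<^sup>+x. ennreal (f n x) \<partial>M) = ennreal (\<integral>x. f n x \<partial>M)"
      using f by (intro nn_integral_eq_integral) auto
    then show "(\<integral>\<^sup>+x. ennreal (f n x) \<partial>M) \<le> ennreal (A n)"
      using bnd(1) by (simp add: ennreal_leI)
  qed
  also have "\<dots> = ennreal a"
    by (intro lim_imp_Liminf tendsto_ennrealI bnd(2)) simp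
  finally have le: "(\<integral>\<^sup>+x. ennreal (g x) \<partial>M) \<le> ennreal a" .
  then show int: "integrable M g"
    using gnn by (intro integrableI_nonneg) (auto simp: le_less_trans)
  show "(\<integral>x. g x \<partial>M) \<le> a"
    using le gnn a by (subst (asm) nn_integral_eq_integral[OF int]) auto
qed

text \<open>The smoothed modulus \<open>y = sqrt (s^2 + e^2)\<close> followed by
  \<open>y / (1 + e y)\<close>: a \<open>C^1\<close> substitute for the modulus that is bounded,
  bounded away from 0, and has slope at most 1.\<close>

definition soft_abs :: "real \<Rightarrow> real \<Rightarrow> real" where
  "soft_abs e s = sqrt (s\<^sup>2 + e\<^sup>2) / (1 + e * sqrt (s\<^sup>2 + e\<^sup>2))"

definition soft_abs' :: "real \<Rightarrow> real \<Rightarrow> real" where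
  "soft_abs' e s = s / (sqrt (s\<^sup>2 + e\<^sup>2) * (1 + e * sqrt (s\<^sup>2 + e\<^sup>2))\<^sup>2)"

lemma soft_abs_aux:
  assumes "e > 0" shows "s\<^sup>2 + e\<^sup>2 > 0" "1 + e * sqrt (s\<^sup>2 + e\<^sup>2) > 0" "sqrt (s\<^sup>2 + e\<^sup>2) \<ge> e"
    "sqrt (s\<^sup>2 + e\<^sup>2) > 0" "sqrt (s\<^sup>2 + e\<^sup>2) \<ge> \<bar>s\<bar>"
proof -
  show 1: "s\<^sup>2 + e\<^sup>2 > 0" using assms by (simp add: add_nonneg_pos)
  then show 2: "sqrt (s\<^sup>2 + e\<^sup>2) > 0" by simp
  then show "1 + e * sqrt (s\<^sup>2 + e\<^sup>2) > 0" using assms by (simp add: add_pos_pos)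
  show "sqrt (s\<^sup>2 + e\<^sup>2) \<ge> e" by (rule real_le_rsqrt) simp
  show "sqrt (s\<^sup>2 + e\<^sup>2) \<ge> \<bar>s\<bar>" by (rule real_le_rsqrt) simp
qed

lemma soft_abs_deriv:
  assumes "e > 0"
  shows "(soft_abs e has_real_derivative soft_abs' e s) (at s)"
proof -
  note aux = soft_abs_aux[OF assms, of s]
  define y where "y = sqrt (s\<^sup>2 + e\<^sup>2)"
  have y: "((\<lambda>s. sqrt (s\<^sup>2 + e\<^sup>2)) has_real_derivative s / y) (at s)"
    using aux by (auto intro!: derivative_eq_intros simp: y_def field_simps)
  have "((\<lambda>s. 1 + e * sqrt (s\<^sup>2 + e\<^sup>2)) has_real_derivative e * (s / y)) (at s)"
    using DERIV_add[OF DERIV_const[of 1] DERIV_cmult[OF y, of e]] by simp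
  from DERIV_divide[OF y this]
  have "((\<lambda>s. sqrt (s\<^sup>2 + e\<^sup>2) / (1 + e * sqrt (s\<^sup>2 + e\<^sup>2))) has_real_derivative
     (s / y * (1 + e * y) - y * (e * (s / y))) / ((1 + e * y) * (1 + e * y))) (at s)"
    using aux(2) by (simp add: y_def)
  moreover have "(s / y * (1 + e * y) - y * (e * (s / y))) / ((1 + e * y) * (1 + e * y)) = soft_abs' e s"
    using aux unfolding soft_abs'_def y_def[symmetric] by (simp add: field_simps power2_eq_square)
  ultimately show ?thesis by (simp add: soft_abs_def[abs_def])
qed

lemma abs_soft_abs'_le:
  assumes "e > 0" shows "\<bar>soft_abs' e s\<bar> \<le> 1"
proof -
  note aux = soft_abs_aux[OF assms, of s]
  have "1 \<le> (1 + e * sqrt (s\<^sup>2 + e\<^sup>2))\<^sup>2"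
    using aux assms by (intro one_le_power) simp
  then have "\<bar>s\<bar> * 1 \<le> sqrt (s\<^sup>2 + e\<^sup>2) * (1 + e * sqrt (s\<^sup>2 + e\<^sup>2))\<^sup>2"
    using aux by (intro mult_mono) auto
  then show ?thesis using aux by (simp add: soft_abs'_def abs_mult divide_le_eq)
qed

lemma soft_abs_bounds:
  assumes "e > 0"
  shows "e / (1 + e\<^sup>2) \<le> soft_abs e s" "soft_abs e s \<le> 1 / e" "(soft_abs e s)\<^sup>2 \<le> s\<^sup>2 + e\<^sup>2"
proof -
  note aux = soft_abs_aux[OF assms, of s]
  define y where "y = sqrt (s\<^sup>2 + e\<^sup>2)"
  have y: "y \<ge> e" "y > 0" using aux by (auto simp: y_def)
  have p: "1 + e\<^sup>2 > 0" "1 + e * y > 0" using assms y by (auto simp: add_pos_nonneg)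
  show "e / (1 + e\<^sup>2) \<le> soft_abs e s"
    unfolding soft_abs_def y_def[symmetric] using p y assms
    by (simp add: frac_le_eq divide_le_0_iff) (simp add: algebra_simps power2_eq_square)
  show "soft_abs e s \<le> 1 / e"
    unfolding soft_abs_def y_def[symmetric] using p assms by (simp add: field_simps)
  have "soft_abs e s \<le> y"
    unfolding soft_abs_def y_def[symmetric] using p y assms by (simp add: divide_le_eq algebra_simps)
  moreover have "0 \<le> soft_abs e s"
    unfolding soft_abs_def y_def[symmetric] using p y by simp
  ultimately have "(soft_abs e s)\<^sup>2 \<le> y\<^sup>2" by (intro power_mono)
  then show "(soft_abs e s)\<^sup>2 \<le> s\<^sup>2 + e\<^sup>2" using aux(1) by (simp add: y_def)
qed

lemma soft_abs_tendsto:
  assumes "e \<longlonglongrightarrow> 0" shows "(\<lambda>n. soft_abs (e n) s) \<longlonglongrightarrow> \<bar>s\<bar>"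
proof -
  have "(\<lambda>n. soft_abs (e n) s) \<longlonglongrightarrow> sqrt (s\<^sup>2 + 0\<^sup>2) / (1 + 0 * sqrt (s\<^sup>2 + 0\<^sup>2))"
    unfolding soft_abs_def by (intro tendsto_intros assms) simp
  then show ?thesis by simp
qed

lemma continuous_on_soft_abs': "e > 0 \<Longrightarrow> continuous_on S (soft_abs' e)"
  unfolding soft_abs'_def
  by (intro continuous_intros) (use soft_abs_aux(2,4) in \<open>auto simp: less_le\<close>)

context log_Sobolev_space
begin

text \<open>The derivative in q of the squared \<open>L^q\<close> norm is a positive multiple of the
  entropy of \<open>u^q\<close>. After the logarithmic Sobolev inequality for
  \<open>u^(q/2)\<close>, Holder's inequality produces exactly the power of \<open>I q\<close>
  needed to cancel the norm of \<open>u\<close>, so the derivative is at most c times the squared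
  \<open>L^p\<close> norm of \<open>w\<close>.\<close>

lemma moment_growth_bounded:
  assumes u: "C_on (Suc 0) G u" and ab: "a > 0" "\<And>x. x \<in> G \<Longrightarrow> a \<le> u x" "\<And>x. x \<in> G \<Longrightarrow> u x \<le> b"
    and w: "\<And>x. x \<in> G \<Longrightarrow> norm (grad u x) \<le> w x"
    and [measurable]: "w \<in> borel_measurable M" and int: "integrable M (\<lambda>x. w x powr p)" and "p \<ge> 2"
  shows "(\<integral>x. u x powr p \<partial>M) powr (2 / p)
    \<le> (\<integral>x. (u x)\<^sup>2 \<partial>M) + c * (p - 2) * (\<integral>x. w x powr p \<partial>M) powr (2 / p)"
proof -
  have [measurable]: "u \<in> borel_measurable M"
    by (intro measurable_continuous C_on_imp_continuous[OF u])
  have pos: "u x > 0" if "x \<in> G" for x using ab(1) ab(2)[OF that] by linarith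
  have wnn: "w x \<ge> 0" if "x \<in> G" for x using w[OF that] norm_ge_zero by (rule order_trans[rotated])
  have u2: "(\<integral>x. u x powr 2 \<partial>M) = (\<integral>x. (u x)\<^sup>2 \<partial>M)"
    by (intro Bochner_Integration.integral_cong) (auto simp: pos less_imp_le)
  have ub: "u x powr q \<le> max (a powr q) (b powr q)" if "x \<in> G" for q x
  proof (cases "q \<ge> 0")
    case True
    then have "u x powr q \<le> b powr q" using ab(3)[OF that] pos[OF that] by (intro powr_mono2) auto
    then show ?thesis by simp
  next
    case False
    then have "u x powr q \<le> a powr q" using ab(1) ab(2)[OF that] by (intro powr_mono2') auto
    then show ?thesis by simp
  qed
  have intu: "integrable M (\<lambda>x. u x powr q)" for q
    by (rule integrable_bounded[of _ "max (a powr q) (b powr q)"]) (use ub in auto)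
  define W where "W = (\<integral>x. w x powr p \<partial>M) powr (2 / p)"
  define I where "I q = (\<integral>x. u x powr q \<partial>M)" for q
  define I' where "I' q = (\<integral>x. u x powr q * ln (u x) \<partial>M)" for q
  have dI: "(I has_real_derivative I' q) (at q)" for q
    unfolding I_def I'_def by (rule has_derivative_moment[OF prob_space_axioms, of u a b]) (use ab in auto)
  have I: "I q > 0" for q
    unfolding I_def by (rule expectation_greater[OF intu], rule AE_I2) (simp add: less_imp_neq[OF pos, symmetric])
  \<comment> \<open>Written with exp and ln because q enters both through the moment and through the
    exponent.\<close>
  define \<Phi> where "\<Phi> q = exp (2 / q * ln (I q))" for q
  have \<Phi>: "\<Phi> q = I q powr (2 / q)" for q using I[of q] by (simp add: \<Phi>_def powr_def)
  define \<Phi>' where "\<Phi>' q = \<Phi> q * (2 / q * (I' q / I q) - 2 / q\<^sup>2 * ln (I q))" for q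
  have d\<Phi>: "(\<Phi> has_real_derivative \<Phi>' q) (at q)" if "q > 0" for q
    unfolding \<Phi>_def \<Phi>'_def using that I[of q]
    by (auto intro!: derivative_eq_intros dI simp: power2_eq_square field_simps)
  have bound: "\<Phi>' q \<le> c * W" if q: "2 < q" "q < p" for q
  proof -
    have v: "C_on (Suc 0) G (\<lambda>x. u x powr (q / 2))"
      "\<And>x. x \<in> G \<Longrightarrow> grad (\<lambda>x. u x powr (q / 2)) x = (q / 2 * u x powr (q / 2 - 1)) *\<^sub>R grad u x"
    proof -
      have d: "((\<lambda>s. s powr (q / 2)) has_real_derivative q / 2 * u x powr (q / 2 - 1)) (at (u x))"
        if "x \<in> G" for x
        using has_real_derivative_powr[OF pos[OF that], of "q / 2"] by simp
      have cont: "continuous_on (u ` G) (\<lambda>s. q / 2 * s powr (q / 2 - 1))"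
        by (intro continuous_intros) (auto dest: pos)
      show "C_on (Suc 0) G (\<lambda>x. u x powr (q / 2))"
        by (rule C_on_compose_real(1)[OF open_G u d cont])
      show "grad (\<lambda>x. u x powr (q / 2)) x = (q / 2 * u x powr (q / 2 - 1)) *\<^sub>R grad u x" if "x \<in> G" for x
        by (rule C_on_compose_real(2)[OF open_G u d cont that])
    qed
    have q0: "0 < 2 / q" "2 / q < 1" using q by auto
    have intwq: "integrable M (\<lambda>x. w x powr q)" and wq: "(\<integral>x. w x powr q \<partial>M) powr (2 / q) \<le> W"
      using moment_mono[of w p q] wnn int q unfolding W_def by auto
    have sqv: "(u x powr (q / 2))\<^sup>2 = u x powr q" for x
      by (simp add: power2_eq_square flip: powr_add)
    \<comment> \<open>The energy density for \<open>u powr (q / 2)\<close>, split so that Holder's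
      inequality with weight 2/q sees only q-th moments.\<close>
    have mix: "(u x powr q) powr (1 - 2 / q) * (w x powr q) powr (2 / q) = u x powr (q - 2) * (w x)\<^sup>2" if "x \<in> G" for x
      using q wnn[OF that] by (simp add: powr_powr algebra_simps)
    note H = Holder_interpolation[OF intu[of q] _ intwq _ q0]
    have intmix: "integrable M (\<lambda>x. u x powr (q - 2) * (w x)\<^sup>2)"
      by (rule Bochner_Integration.integrable_cong[THEN iffD1, OF refl _ H(1)]) (auto simp: mix)
    have J: "(\<integral>x. u x powr (q - 2) * (w x)\<^sup>2 \<partial>M) \<le> I q powr (1 - 2 / q) * W"
    proof -
      have "(\<integral>x. u x powr (q - 2) * (w x)\<^sup>2 \<partial>M) = (\<integral>x. (u x powr q) powr (1 - 2 / q) * (w x powr q) powr (2 / q) \<partial>M)"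
        by (rule Bochner_Integration.integral_cong) (auto simp: mix)
      also have "\<dots> \<le> I q powr (1 - 2 / q) * (\<integral>x. w x powr q \<partial>M) powr (2 / q)"
        using H(2) by (simp add: I_def)
      also have "\<dots> \<le> I q powr (1 - 2 / q) * W" by (intro mult_left_mono wq) auto
      finally show ?thesis .
    qed
    have wsq: "(q / 2 * u x powr (q / 2 - 1) * w x)\<^sup>2 = q\<^sup>2 / 4 * (u x powr (q - 2) * (w x)\<^sup>2)" for x
    proof -
      have "(u x powr (q / 2 - 1))\<^sup>2 = u x powr (q - 2)"
        by (simp add: power2_eq_square flip: powr_add)
      then show ?thesis by (simp add: power_mult_distrib power_divide)
    qed
    have "Ent M (\<lambda>x. (u x powr (q / 2))\<^sup>2) \<le> 2 * c * (\<integral>x. (q / 2 * u x powr (q / 2 - 1) * w x)\<^sup>2 \<partial>M)"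
    proof (rule log_Sobolev_C1[OF v(1), of "b powr (q / 2)"])
      fix x assume x: "x \<in> G"
      show "0 < u x powr (q / 2)" using pos[OF x] by simp
      show "u x powr (q / 2) \<le> b powr (q / 2)" using pos[OF x] ab(3)[OF x] q by (intro powr_mono2) auto
      show "norm (grad (\<lambda>x. u x powr (q / 2)) x) \<le> q / 2 * u x powr (q / 2 - 1) * w x"
        unfolding v(2)[OF x] using w[OF x] q by (auto simp: abs_mult intro!: mult_left_mono)
    next
      show "integrable M (\<lambda>x. (q / 2 * u x powr (q / 2 - 1) * w x)\<^sup>2)"
        unfolding wsq using intmix by simp
    qed
    also have "\<dots> = c * q\<^sup>2 / 2 * (\<integral>x. u x powr (q - 2) * (w x)\<^sup>2 \<partial>M)"
      unfolding wsq by simp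
    also have "\<dots> \<le> c * q\<^sup>2 / 2 * (I q powr (1 - 2 / q) * W)"
      using c_pos by (intro mult_left_mono J) auto
    also have "Ent M (\<lambda>x. (u x powr (q / 2))\<^sup>2) = q * I' q - I q * ln (I q)"
    proof -
      have "(\<integral>x. u x powr q * ln (u x powr q) \<partial>M) = (\<integral>x. q * (u x powr q * ln (u x)) \<partial>M)"
        by (rule Bochner_Integration.integral_cong) (use pos in \<open>auto simp: ln_powr\<close>)
      then show ?thesis by (simp add: Ent_def sqv I_def I'_def)
    qed
    finally have E: "q * I' q - I q * ln (I q) \<le> c * q\<^sup>2 / 2 * (I q powr (1 - 2 / q) * W)" .
    have "\<Phi>' q = \<Phi> q * (2 / (q\<^sup>2 * I q)) * (q * I' q - I q * ln (I q))"
      unfolding \<Phi>'_def using q I[of q] by (simp add: field_simps power2_eq_square)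
    also have "\<dots> \<le> \<Phi> q * (2 / (q\<^sup>2 * I q)) * (c * q\<^sup>2 / 2 * (I q powr (1 - 2 / q) * W))"
      using I[of q] by (intro mult_left_mono E) (auto simp: \<Phi>_def)
    also have "\<dots> = c * W * (\<Phi> q * I q powr (1 - 2 / q) / I q)"
      using q I[of q] by (simp add: field_simps power2_eq_square)
    also have "\<Phi> q * I q powr (1 - 2 / q) = I q"
      using I[of q] by (simp add: \<Phi> flip: powr_add)
    finally show ?thesis using I[of q] by simp
  qed
  have "\<Phi> p \<le> \<Phi> 2 + c * (p - 2) * W"
  proof (cases "p = 2")
    case False
    with \<open>p \<ge> 2\<close> have "2 < p" by simp
    \<comment> \<open>The mean value theorem gives an interior point, hence q > 2 strictly, as a
      Holder weight 2/q below 1 demands. For p = 2 the claim is an identity.\<close>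
    from MVT2[OF this d\<Phi>] obtain z where z: "2 < z" "z < p" "\<Phi> p - \<Phi> 2 = (p - 2) * \<Phi>' z" by auto
    have "(p - 2) * \<Phi>' z \<le> (p - 2) * (c * W)" using \<open>2 < p\<close> bound z by (intro mult_left_mono) auto
    then show ?thesis using z(3) by (simp add: algebra_simps)
  qed simp
  then show ?thesis using I[of 2] u2 unfolding \<Phi> I_def W_def by simp
qed

text \<open>Composition with \<open>soft_abs\<close> makes the function bounded and positive, does
  not enlarge its gradient, and raises its square by at most \<open>e^2\<close>. The bounds thus
  converge along e = 1/(n+1).\<close>

lemma moment_growth:
  assumes u: "C_on (Suc 0) G u" and intu: "integrable M (\<lambda>x. (u x)\<^sup>2)"
    and w: "\<And>x. x \<in> G \<Longrightarrow> norm (grad u x) \<le> w x"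
    and wm: "w \<in> borel_measurable M" and int: "integrable M (\<lambda>x. w x powr p)" and "p \<ge> 2"
  shows "integrable M (\<lambda>x. \<bar>u x\<bar> powr p)"
    and "(\<integral>x. \<bar>u x\<bar> powr p \<partial>M) powr (2 / p)
    \<le> (\<integral>x. (u x)\<^sup>2 \<partial>M) + c * (p - 2) * (\<integral>x. w x powr p \<partial>M) powr (2 / p)"
proof -
  define R where "R = c * (p - 2) * (\<integral>x. w x powr p \<partial>M) powr (2 / p)"
  define S where "S = (\<integral>x. (u x)\<^sup>2 \<partial>M)"
  have RS: "R \<ge> 0" "S \<ge> 0" using c_pos \<open>p \<ge> 2\<close> by (auto simp: R_def S_def)
  define e where "e n = 1 / real (Suc n)" for n
  have e: "e n > 0" for n by (simp add: e_def)
  have e0: "e \<longlonglongrightarrow> 0" unfolding e_def by (rule LIMSEQ_Suc) (rule lim_1_over_n)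
  define v where "v n x = soft_abs (e n) (u x)" for n x
  have v: "C_on (Suc 0) G (v n)" "\<And>x. x \<in> G \<Longrightarrow> grad (v n) x = soft_abs' (e n) (u x) *\<^sub>R grad u x" for n
    unfolding v_def[abs_def]
    by (rule C_on_compose_real[OF open_G u soft_abs_deriv[OF e] continuous_on_soft_abs'[OF e]], assumption?)+
  have [measurable]: "v n \<in> borel_measurable M" "u \<in> borel_measurable M" for n
    using C_on_imp_continuous[OF v(1)] C_on_imp_continuous[OF u] by (auto intro: measurable_continuous)
  have vpos: "v n x > 0" for n x
    using soft_abs_bounds(1)[OF e[of n], of "u x"] e[of n] unfolding v_def
    by (smt (verit) divide_pos_pos zero_le_power2)
  have vle: "v n x \<le> 1 / e n" for n x
    unfolding v_def by (rule soft_abs_bounds(2)[OF e])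
  have vint: "integrable M (\<lambda>x. v n x powr p)" for n
    by (rule integrable_bounded[of _ "(1 / e n) powr p"])
      (use vpos vle \<open>p \<ge> 2\<close> in \<open>auto simp: less_imp_le intro!: powr_mono2\<close>)
  have vb: "(\<integral>x. v n x powr p \<partial>M) \<le> (S + (e n)\<^sup>2 + R) powr (p / 2)" for n
  proof -
    have "(\<integral>x. v n x powr p \<partial>M) powr (2 / p) \<le> (\<integral>x. (v n x)\<^sup>2 \<partial>M) + R"
      unfolding R_def
    proof (rule moment_growth_bounded[OF v(1) _ _ _ _ wm int \<open>p \<ge> 2\<close>, of "e n / (1 + (e n)\<^sup>2)" _ "1 / e n"])
      show "0 < e n / (1 + (e n)\<^sup>2)" using e[of n] by (simp add: add_pos_nonneg)
      fix x assume x: "x \<in> G"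
      show "norm (grad (v n) x) \<le> w x"
        unfolding v(2)[OF x] using abs_soft_abs'_le[OF e[of n], of "u x"] w[OF x]
        by simp (meson mult_left_le_one_le norm_ge_zero abs_ge_zero order_trans)
    qed (use soft_abs_bounds[OF e[of n]] in \<open>auto simp: v_def\<close>)
    also have "(\<integral>x. (v n x)\<^sup>2 \<partial>M) \<le> (\<integral>x. (u x)\<^sup>2 + (e n)\<^sup>2 \<partial>M)"
    proof (rule integral_mono)
      show "integrable M (\<lambda>x. (v n x)\<^sup>2)"
        by (rule integrable_bounded[of _ "(1 / e n)\<^sup>2"])
          (use power_mono[OF vle less_imp_le[OF vpos], of _ _ 2] in auto)
    qed (use intu soft_abs_bounds(3)[OF e[of n]] in \<open>auto simp: v_def\<close>)
    also have "\<dots> = S + (e n)\<^sup>2" using intu by (simp add: S_def)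
    finally have "((\<integral>x. v n x powr p \<partial>M) powr (2 / p)) powr (p / 2) \<le> (S + (e n)\<^sup>2 + R) powr (p / 2)"
      using \<open>p \<ge> 2\<close> by (intro powr_mono2) auto
    then show ?thesis using \<open>p \<ge> 2\<close> by (simp add: powr_powr)
  qed
  have lim: "(\<lambda>n. v n x powr p) \<longlonglongrightarrow> \<bar>u x\<bar> powr p" for x
    unfolding v_def using \<open>p \<ge> 2\<close>
    by (intro tendsto_powr' soft_abs_tendsto[OF e0] tendsto_const) (use vpos[unfolded v_def] in \<open>auto simp: less_imp_le\<close>)
  have limA: "(\<lambda>n. (S + (e n)\<^sup>2 + R) powr (p / 2)) \<longlonglongrightarrow> (S + 0\<^sup>2 + R) powr (p / 2)"
    using \<open>p \<ge> 2\<close> RS by (intro tendsto_powr' tendsto_intros e0) auto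
  note F = Fatou_bound[OF vint _ lim vb limA]
  show "integrable M (\<lambda>x. \<bar>u x\<bar> powr p)" using F(1) by simp
  have "(\<integral>x. \<bar>u x\<bar> powr p \<partial>M) powr (2 / p) \<le> ((S + R) powr (p / 2)) powr (2 / p)"
    using F(2) \<open>p \<ge> 2\<close> by (intro powr_mono2) auto
  also have "\<dots> = S + R" using RS \<open>p \<ge> 2\<close> by (simp add: powr_powr)
  finally show "(\<integral>x. \<bar>u x\<bar> powr p \<partial>M) powr (2 / p)
    \<le> (\<integral>x. (u x)\<^sup>2 \<partial>M) + c * (p - 2) * (\<integral>x. w x powr p \<partial>M) powr (2 / p)"
    by (simp add: R_def S_def)
qed

end

section \<open>The Poincare inequality\<close>

text \<open>The difference of the two sides vanishes at 0 and has a derivative of one sign on each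
  side. For positive y the quadratic polynomial alone is a lower bound; for negative y the cubic
  term compensates.\<close>

lemma ln_add_one_lower:
  fixes y :: real
  assumes "\<bar>y\<bar> \<le> 1/2"
  shows "y - y\<^sup>2 / 2 - \<bar>y\<bar> ^ 3 \<le> ln (1 + y)"
proof (cases "y \<ge> 0")
  case True
  have "0 - 0\<^sup>2 / 2 - ln (1 + 0) \<ge> y - y\<^sup>2 / 2 - ln (1 + y)"
  proof (rule DERIV_nonpos_imp_nonincreasing[OF True])
    fix x :: real assume x: "0 \<le> x" "x \<le> y"
    have "((\<lambda>y. y - y\<^sup>2 / 2 - ln (1 + y)) has_real_derivative (1 - x - 1 / (1 + x))) (at x)"
      using x by (auto intro!: derivative_eq_intros)
    moreover have "1 - x - 1 / (1 + x) = - (x\<^sup>2 / (1 + x))" using x by (simp add: field_simps power2_eq_square)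
    ultimately show "\<exists>d. ((\<lambda>y. y - y\<^sup>2 / 2 - ln (1 + y)) has_real_derivative d) (at x) \<and> d \<le> 0"
      using x by (intro exI[of _ "1 - x - 1 / (1 + x)"]) simp
  qed
  then have "y - y\<^sup>2 / 2 \<le> ln (1 + y)" by simp
  moreover have "\<bar>y\<bar> ^ 3 \<ge> 0" by simp
  ultimately show ?thesis by linarith
next
  case False
  then have y: "y \<le> 0" by simp
  have "y - y\<^sup>2 / 2 + y ^ 3 - ln (1 + y) \<le> 0 - 0\<^sup>2 / 2 + 0 ^ 3 - ln (1 + 0)"
  proof (rule DERIV_nonneg_imp_nondecreasing[OF y])
    fix x :: real assume x: "y \<le> x" "x \<le> 0"
    then have x2: "x \<ge> - 1/2" using assms by auto
    then have "1 / (1 + x) \<le> 3" by (simp add: divide_le_eq)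
    then have "0 \<le> x\<^sup>2 * (3 - 1 / (1 + x))" by simp
    moreover have "x\<^sup>2 * (3 - 1 / (1 + x)) = 1 - x + 3 * x\<^sup>2 - 1 / (1 + x)"
      using x2 by (simp add: field_simps power2_eq_square)
    moreover have "((\<lambda>y. y - y\<^sup>2 / 2 + y ^ 3 - ln (1 + y)) has_real_derivative (1 - x + 3 * x\<^sup>2 - 1 / (1 + x))) (at x)"
      using x2 by (auto intro!: derivative_eq_intros)
    ultimately show "\<exists>d. ((\<lambda>y. y - y\<^sup>2 / 2 + y ^ 3 - ln (1 + y)) has_real_derivative d) (at x) \<and> d \<ge> 0"
      by (intro exI[of _ "1 - x + 3 * x\<^sup>2 - 1 / (1 + x)"]) simp
  qed
  then show ?thesis using y by (simp add: power3_eq_cube)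
qed

text \<open>Second-order expansion of the entropy density at 1. Before doubling, the quartic term
  costs at most a quarter of \<open>|y|^3\<close> and the factor \<open>(1 + y)^2\<close> at most
  9/4 of it, together less than 3.\<close>

lemma entropy_integrand_lower:
  fixes y :: real
  assumes "\<bar>y\<bar> \<le> 1/2"
  shows "2 * y + 3 * y\<^sup>2 - 6 * \<bar>y\<bar> ^ 3 \<le> (1 + y)\<^sup>2 * ln ((1 + y)\<^sup>2)"
proof -
  have a: "\<bar>y\<bar> ^ 3 \<ge> 0" by simp
  have "y ^ 4 = \<bar>y\<bar> * \<bar>y\<bar> ^ 3"
    by (simp add: power4_eq_xxxx power3_eq_cube abs_mult_self_eq mult.assoc)
  also have "\<dots> \<le> 1/2 * \<bar>y\<bar> ^ 3" using assms a by (intro mult_right_mono) auto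
  finally have y4: "y ^ 4 \<le> 1/2 * \<bar>y\<bar> ^ 3" .
  have "(1 + y)\<^sup>2 \<le> (3/2)\<^sup>2" using assms by (intro power_mono) auto
  then have "(1 + y)\<^sup>2 * \<bar>y\<bar> ^ 3 \<le> (9/4) * \<bar>y\<bar> ^ 3" using a by (intro mult_right_mono) (auto simp: power2_eq_square)
  moreover have "(1 + y)\<^sup>2 * (y - y\<^sup>2 / 2) = y + 3/2 * y\<^sup>2 - y ^ 4 / 2"
    by (simp add: power2_eq_square power4_eq_xxxx field_simps)
  ultimately have "y + 3/2 * y\<^sup>2 - 3 * \<bar>y\<bar> ^ 3 \<le> (1 + y)\<^sup>2 * (y - y\<^sup>2 / 2 - \<bar>y\<bar> ^ 3)"
    using y4 a unfolding right_diff_distrib[of _ "y - y\<^sup>2 / 2"] by linarith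
  also have "\<dots> \<le> (1 + y)\<^sup>2 * ln (1 + y)"
    by (intro mult_left_mono ln_add_one_lower assms) simp
  also have "ln (1 + y) = ln ((1 + y)\<^sup>2) / 2" using assms by (simp add: ln_realpow)
  finally show ?thesis by simp
qed

text \<open>A bounded truncation which, unlike \<open>soft_abs\<close>, keeps the sign, so truncated
  functions converge to the original and their means to its mean.\<close>

definition soft_clip :: "real \<Rightarrow> real \<Rightarrow> real" where
  "soft_clip e s = s / sqrt (1 + e * s\<^sup>2)"

lemma soft_clip_facts:
  assumes "e > 0"
  shows "(soft_clip e has_real_derivative (1 / ((1 + e * s\<^sup>2) * sqrt (1 + e * s\<^sup>2)))) (at s)"
    and "\<bar>1 / ((1 + e * s\<^sup>2) * sqrt (1 + e * s\<^sup>2))\<bar> \<le> 1"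
    and "\<bar>soft_clip e s\<bar> \<le> \<bar>s\<bar>" and "\<bar>soft_clip e s\<bar> \<le> 1 / sqrt e"
    and "continuous_on S (\<lambda>s. 1 / ((1 + e * s\<^sup>2) * sqrt (1 + e * s\<^sup>2)))"
proof -
  have pos: "1 + e * s\<^sup>2 > 0" for s using assms by (simp add: add_pos_nonneg)
  have ge: "1 + e * s\<^sup>2 \<ge> 1" using assms by simp
  define y where "y = sqrt (1 + e * s\<^sup>2)"
  have y: "y \<ge> 1" "y * y = 1 + e * s\<^sup>2" "y \<ge> sqrt e * \<bar>s\<bar>"
  proof -
    show "y \<ge> 1" using ge by (simp add: y_def)
    show "y * y = 1 + e * s\<^sup>2" using ge by (simp add: y_def)
    have "sqrt e * \<bar>s\<bar> = sqrt (e * s\<^sup>2)" using assms by (simp add: real_sqrt_mult)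
    also have "\<dots> \<le> y" by (simp add: y_def)
    finally show "y \<ge> sqrt e * \<bar>s\<bar>" .
  qed
  have "((\<lambda>s. sqrt (1 + e * s\<^sup>2)) has_real_derivative e * s / y) (at s)"
    using pos[of s] by (auto intro!: derivative_eq_intros simp: y_def field_simps)
  from DERIV_divide[OF DERIV_ident this]
  have "(soft_clip e has_real_derivative (1 * y - s * (e * s / y)) / (y * y)) (at s)"
    using y by (simp add: y_def soft_clip_def[abs_def])
  moreover have "(1 * y - s * (e * s / y)) / (y * y) = (y * y - e * s\<^sup>2) / (y * y * y)"
    using y(1) by (simp add: field_simps power2_eq_square)
  ultimately have "(soft_clip e has_real_derivative (1 / ((1 + e * s\<^sup>2) * y))) (at s)"
    by (simp add: y(2))
  then show "(soft_clip e has_real_derivative (1 / ((1 + e * s\<^sup>2) * sqrt (1 + e * s\<^sup>2)))) (at s)"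
    by (simp only: y_def)
  have "1 \<le> (1 + e * s\<^sup>2) * y" using mult_mono[OF ge y(1)] ge by simp
  then show "\<bar>1 / ((1 + e * s\<^sup>2) * sqrt (1 + e * s\<^sup>2))\<bar> \<le> 1"
    unfolding y_def[symmetric] using ge y(1) by (simp add: abs_mult)
  have "\<bar>s\<bar> * 1 \<le> \<bar>s\<bar> * y" using y(1) by (intro mult_left_mono) auto
  then show "\<bar>soft_clip e s\<bar> \<le> \<bar>s\<bar>"
    unfolding soft_clip_def y_def[symmetric] using y(1) by (simp add: abs_divide divide_le_eq)
  show "\<bar>soft_clip e s\<bar> \<le> 1 / sqrt e"
    unfolding soft_clip_def y_def[symmetric] using y(1,3) assms by (simp add: abs_divide field_simps)
  show "continuous_on S (\<lambda>s. 1 / ((1 + e * s\<^sup>2) * sqrt (1 + e * s\<^sup>2)))"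
    using pos by (intro continuous_intros) (auto simp: less_imp_neq[OF pos, symmetric])
qed

context log_Sobolev_space
begin

text \<open>Linearisation of the logarithmic Sobolev inequality at the constant 1: it is applied to
  \<open>1 + \<delta> h\<close>, divided by \<open>\<delta>^2\<close>, and \<delta> tends to 0. The
  mean-zero condition removes the first-order term.\<close>

lemma Poincare_bounded:
  assumes h: "C_on (Suc 0) G h" and B: "\<And>x. x \<in> G \<Longrightarrow> \<bar>h x\<bar> \<le> B"
    and mean: "(\<integral>x. h x \<partial>M) = 0"
    and w: "\<And>x. x \<in> G \<Longrightarrow> norm (grad h x) \<le> w x" "integrable M (\<lambda>x. (w x)\<^sup>2)"
  shows "(\<integral>x. (h x)\<^sup>2 \<partial>M) \<le> c * (\<integral>x. (w x)\<^sup>2 \<partial>M)"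
proof -
  have [measurable]: "h \<in> borel_measurable M"
    by (intro measurable_continuous C_on_imp_continuous[OF h])
  define s where "s = (\<integral>x. (h x)\<^sup>2 \<partial>M)"
  define W where "W = (\<integral>x. (w x)\<^sup>2 \<partial>M)"
  define K where "K = \<bar>B\<bar> + 1"
  have "\<bar>h x\<bar> \<le> K" if "x \<in> G" for x using B[OF that] unfolding K_def by linarith
  then have K: "K > 0" "\<And>x. x \<in> G \<Longrightarrow> \<bar>h x\<bar> \<le> K" by (auto simp: K_def)
  have inth: "integrable M h" by (rule integrable_bounded[of _ K]) (use K in auto)
  have inth2: "integrable M (\<lambda>x. (h x)\<^sup>2)"
    by (rule integrable_bounded[of _ "K\<^sup>2"]) (use power_mono[OF K(2), of _ 2] in auto)
  have step: "2 * s - 6 * \<delta> * K ^ 3 - \<delta>\<^sup>2 * s\<^sup>2 \<le> 2 * c * W" if \<delta>: "\<delta> > 0" "\<delta> * K \<le> 1/2" for \<delta>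
  proof -
    define v where "v x = 1 + \<delta> * h x" for x
    have y: "\<bar>\<delta> * h x\<bar> \<le> \<delta> * K" if "x \<in> G" for x
      using K(2)[OF that] \<delta> by (simp add: abs_mult)
    have y2: "\<bar>\<delta> * h x\<bar> \<le> 1/2" if "x \<in> G" for x
      using y[OF that] \<delta>(2) by linarith
    have v: "C_on (Suc 0) G v" "\<And>x. x \<in> G \<Longrightarrow> grad v x = \<delta> *\<^sub>R grad h x"
      unfolding v_def[abs_def]
      by (rule C_on_compose_real[OF open_G h, where \<theta>="\<lambda>s. 1 + \<delta> * s" and \<theta>'="\<lambda>s. \<delta>"];
          auto intro!: derivative_eq_intros)+
    have vb: "0 < v x" "v x \<le> 3/2" if "x \<in> G" for x using y2[OF that] by (auto simp: v_def)
    have [measurable]: "v \<in> borel_measurable M" unfolding v_def[abs_def] by measurable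
    have E: "Ent M (\<lambda>x. (v x)\<^sup>2) \<le> 2 * c * (\<delta>\<^sup>2 * W)"
    proof -
      have "Ent M (\<lambda>x. (v x)\<^sup>2) \<le> 2 * c * (\<integral>x. (\<delta> * w x)\<^sup>2 \<partial>M)"
        by (rule log_Sobolev_C1[OF v(1) vb]) (use w \<delta> v(2) in \<open>auto simp: power_mult_distrib\<close>)
      then show ?thesis by (simp add: power_mult_distrib W_def)
    qed
    have A: "(\<integral>x. (v x)\<^sup>2 \<partial>M) = 1 + \<delta>\<^sup>2 * s"
    proof -
      have "(\<integral>x. (v x)\<^sup>2 \<partial>M) = (\<integral>x. 1 + (2 * \<delta>) * h x + \<delta>\<^sup>2 * (h x)\<^sup>2 \<partial>M)"
        by (simp add: v_def power2_eq_square algebra_simps)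
      also have "\<dots> = 1 + \<delta>\<^sup>2 * s" using inth inth2 mean by (simp add: s_def)
      finally show ?thesis .
    qed
    have s0: "s \<ge> 0" by (simp add: s_def)
    have Apos: "1 + \<delta>\<^sup>2 * s > 0" using s0 by (simp add: add_pos_nonneg)
    \<comment> \<open>To second order in \<delta> the integral of the entropy density contributes 3s
      and the subtracted term s; the difference 2s meets the 2c of the hypothesis, which is why the
      constant is exactly c.\<close>
    have lnA: "(1 + \<delta>\<^sup>2 * s) * ln (1 + \<delta>\<^sup>2 * s) \<le> (1 + \<delta>\<^sup>2 * s) * (\<delta>\<^sup>2 * s)"
      using ln_le_minus_one[OF Apos] Apos by (intro mult_left_mono) auto
    have "3 * \<delta>\<^sup>2 * s - 6 * (\<delta> * K) ^ 3 = (\<integral>x. (2 * \<delta>) * h x + (3 * \<delta>\<^sup>2) * (h x)\<^sup>2 - 6 * (\<delta> * K) ^ 3 \<partial>M)"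
      using inth inth2 mean by (simp add: s_def)
    also have "\<dots> \<le> (\<integral>x. (v x)\<^sup>2 * ln ((v x)\<^sup>2) \<partial>M)"
    proof (rule integral_mono)
      show "integrable M (\<lambda>x. (2 * \<delta>) * h x + (3 * \<delta>\<^sup>2) * (h x)\<^sup>2 - 6 * (\<delta> * K) ^ 3)"
        using inth inth2 by simp
      show "integrable M (\<lambda>x. (v x)\<^sup>2 * ln ((v x)\<^sup>2))"
      proof (rule integrable_bounded[of _ "1 + ((3/2)\<^sup>2)\<^sup>2"])
        fix x assume "x \<in> G"
        then have "((v x)\<^sup>2)\<^sup>2 \<le> ((3/2)\<^sup>2)\<^sup>2" using vb by (intro power_mono) (auto simp: less_imp_le)
        then show "\<bar>(v x)\<^sup>2 * ln ((v x)\<^sup>2)\<bar> \<le> 1 + ((3/2)\<^sup>2)\<^sup>2"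
          using abs_mult_ln_le[of "(v x)\<^sup>2"] by simp
      qed measurable
      fix x assume "x \<in> space M"
      then have x: "x \<in> G" by simp
      have "\<bar>\<delta> * h x\<bar> ^ 3 \<le> (\<delta> * K) ^ 3" by (rule power_mono[OF y[OF x]]) simp
      then show "(2 * \<delta>) * h x + (3 * \<delta>\<^sup>2) * (h x)\<^sup>2 - 6 * (\<delta> * K) ^ 3 \<le> (v x)\<^sup>2 * ln ((v x)\<^sup>2)"
        using entropy_integrand_lower[OF y2[OF x]] by (simp add: v_def power_mult_distrib)
    qed
    finally have "3 * \<delta>\<^sup>2 * s - 6 * (\<delta> * K) ^ 3 - (1 + \<delta>\<^sup>2 * s) * (\<delta>\<^sup>2 * s) \<le> 2 * c * (\<delta>\<^sup>2 * W)"
      using E lnA by (simp add: Ent_def A)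
    then have "\<delta>\<^sup>2 * (2 * s - 6 * \<delta> * K ^ 3 - \<delta>\<^sup>2 * s\<^sup>2) \<le> \<delta>\<^sup>2 * (2 * c * W)"
      by (simp add: power2_eq_square power3_eq_cube algebra_simps)
    then show ?thesis using \<delta>(1) by simp
  qed
  \<comment> \<open>Scaled by K so that every \<open>\<delta> n * K\<close> is at most 1/2: this
    keeps \<open>v\<close> positive and within the range of the expansion.\<close>
  define \<delta> where "\<delta> n = 1 / (2 * K) * (1 / real (Suc n))" for n
  have \<delta>0: "\<delta> \<longlonglongrightarrow> 0"
    unfolding \<delta>_def using tendsto_mult_right_zero[OF LIMSEQ_Suc[OF lim_1_over_n], of "1 / (2 * K)"] by simp
  have "\<delta> n > 0" for n using K(1) by (simp add: \<delta>_def)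
  moreover have "\<delta> n * K \<le> 1/2" for n
  proof -
    have "\<delta> n * K = 1/2 * (1 / real (Suc n))" using K(1) by (simp add: \<delta>_def)
    moreover have "1 / real (Suc n) \<le> 1" by simp
    ultimately show ?thesis by linarith
  qed
  ultimately have "2 * s - 6 * \<delta> n * K ^ 3 - (\<delta> n)\<^sup>2 * s\<^sup>2 \<le> 2 * c * W" for n by (rule step)
  moreover have "(\<lambda>n. 2 * s - 6 * \<delta> n * K ^ 3 - (\<delta> n)\<^sup>2 * s\<^sup>2) \<longlonglongrightarrow> 2 * s - 6 * 0 * K ^ 3 - 0\<^sup>2 * s\<^sup>2"
    by (intro tendsto_intros \<delta>0)
  ultimately have "2 * s - 6 * 0 * K ^ 3 - 0\<^sup>2 * s\<^sup>2 \<le> 2 * c * W"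
    by (intro LIMSEQ_le_const2[of _ _ "2 * c * W"]) auto
  then show ?thesis by (simp add: s_def W_def)
qed

text \<open>Truncation spoils the mean-zero condition, so the mean \<open>m n\<close> is subtracted.
  This leaves gradients unchanged and costs \<open>(m n)^2\<close>, which tends to 0 by dominated
  convergence.\<close>

lemma Poincare:
  assumes f: "C_on (Suc 0) G f" and int: "integrable M f" and mean: "(\<integral>x. f x \<partial>M) = 0"
    and w: "\<And>x. x \<in> G \<Longrightarrow> norm (grad f x) \<le> w x" "integrable M (\<lambda>x. (w x)\<^sup>2)"
  shows "integrable M (\<lambda>x. (f x)\<^sup>2)" "(\<integral>x. (f x)\<^sup>2 \<partial>M) \<le> c * (\<integral>x. (w x)\<^sup>2 \<partial>M)"
proof -
  have [measurable]: "f \<in> borel_measurable M" using int by auto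
  define e where "e n = 1 / real (Suc n)" for n
  have e: "e n > 0" for n by (simp add: e_def)
  have e0: "e \<longlonglongrightarrow> 0" unfolding e_def by (rule LIMSEQ_Suc) (rule lim_1_over_n)
  note sc = soft_clip_facts[OF e]
  define v where "v n x = soft_clip (e n) (f x)" for n x
  define m where "m n = (\<integral>x. v n x \<partial>M)" for n
  have lim: "(\<lambda>n. v n x) \<longlonglongrightarrow> f x" for x
  proof -
    have "(\<lambda>n. v n x) \<longlonglongrightarrow> f x / sqrt (1 + 0 * (f x)\<^sup>2)"
      unfolding v_def soft_clip_def by (intro tendsto_intros e0) simp
    then show ?thesis by simp
  qed
  have v: "C_on (Suc 0) G (\<lambda>x. v n x - a)"
    "\<And>x. x \<in> G \<Longrightarrow> grad (\<lambda>x. v n x - a) x = (1 / ((1 + e n * (f x)\<^sup>2) * sqrt (1 + e n * (f x)\<^sup>2))) *\<^sub>R grad f x"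
    for n a
  proof -
    have d: "((\<lambda>s. soft_clip (e n) s - a) has_real_derivative
        1 / ((1 + e n * (f x)\<^sup>2) * sqrt (1 + e n * (f x)\<^sup>2))) (at (f x))" for x
      using DERIV_diff[OF sc(1)[of n "f x"] DERIV_const[of a]] by simp
    show "C_on (Suc 0) G (\<lambda>x. v n x - a)" unfolding v_def
      by (rule C_on_compose_real(1)[OF open_G f d sc(5)])
    show "grad (\<lambda>x. v n x - a) x = (1 / ((1 + e n * (f x)\<^sup>2) * sqrt (1 + e n * (f x)\<^sup>2))) *\<^sub>R grad f x"
      if "x \<in> G" for x unfolding v_def
      by (rule C_on_compose_real(2)[OF open_G f d sc(5) that])
  qed
  have [measurable]: "v n \<in> borel_measurable M" for n
    using C_on_imp_continuous[OF v(1)[of n 0]] by (intro measurable_continuous) simp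
  have vf: "\<bar>v n x\<bar> \<le> \<bar>f x\<bar>" "\<bar>v n x\<bar> \<le> 1 / sqrt (e n)" for n x
    unfolding v_def using sc(3,4) by auto
  have intv: "integrable M (v n)" for n
    by (rule integrable_bounded[of _ "1 / sqrt (e n)"]) (use vf in auto)
  have intv2: "integrable M (\<lambda>x. (v n x)\<^sup>2)" for n
    by (rule integrable_bounded[of _ "(1 / sqrt (e n))\<^sup>2"]) (use power_mono[OF vf(2), of _ _ 2] in auto)
  have m0: "m \<longlonglongrightarrow> 0"
    unfolding m_def mean[symmetric]
    by (rule integral_dominated_convergence[where w="\<lambda>x. \<bar>f x\<bar>"]) (use int lim vf in auto)
  have bnd: "(\<integral>x. (v n x)\<^sup>2 \<partial>M) \<le> c * (\<integral>x. (w x)\<^sup>2 \<partial>M) + (m n)\<^sup>2" for n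
  proof -
    have "(\<integral>x. (v n x - m n)\<^sup>2 \<partial>M) \<le> c * (\<integral>x. (w x)\<^sup>2 \<partial>M)"
    proof (rule Poincare_bounded[OF v(1)])
      show "\<bar>v n x - m n\<bar> \<le> 1 / sqrt (e n) + \<bar>m n\<bar>" for x
        using vf(2)[of n x] by linarith
      show "(\<integral>x. v n x - m n \<partial>M) = 0" using intv[of n] by (simp add: m_def)
      fix x assume x: "x \<in> G"
      have "norm (grad (\<lambda>x. v n x - m n) x) \<le> 1 * norm (grad f x)"
        unfolding v(2)[OF x] norm_scaleR by (intro mult_right_mono sc(2)) simp
      then show "norm (grad (\<lambda>x. v n x - m n) x) \<le> w x" using w(1)[OF x] by simp
    qed (rule w(2))
    also have "(\<integral>x. (v n x - m n)\<^sup>2 \<partial>M) = (\<integral>x. (v n x)\<^sup>2 - (2 * m n) * v n x + (m n)\<^sup>2 \<partial>M)"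
      by (simp add: power2_diff algebra_simps)
    also have "\<dots> = (\<integral>x. (v n x)\<^sup>2 \<partial>M) - (m n)\<^sup>2"
      using intv[of n] intv2[of n] by (simp add: m_def power2_eq_square)
    finally show ?thesis by simp
  qed
  have l2: "(\<lambda>n. (v n x)\<^sup>2) \<longlonglongrightarrow> (f x)\<^sup>2" for x by (intro tendsto_intros lim)
  have lA: "(\<lambda>n. c * (\<integral>x. (w x)\<^sup>2 \<partial>M) + (m n)\<^sup>2) \<longlonglongrightarrow> c * (\<integral>x. (w x)\<^sup>2 \<partial>M) + 0\<^sup>2"
    by (intro tendsto_intros m0)
  note F = Fatou_bound[OF intv2 _ l2 bnd lA]
  show "integrable M (\<lambda>x. (f x)\<^sup>2)" using F(1) by simp
  show "(\<integral>x. (f x)\<^sup>2 \<partial>M) \<le> c * (\<integral>x. (w x)\<^sup>2 \<partial>M)" using F(2) by simp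
qed

end

section \<open>Operator norms of derivatives\<close>

abbreviation unit_tuples :: "nat \<Rightarrow> (nat \<Rightarrow> real^'n::finite) set" where
  "unit_tuples k \<equiv> {v. \<forall>j<k. norm (v j) = 1}"

text \<open>The derivative taken last is paired with \<open>v 0\<close>. Differentiating the k-form
  in a direction h therefore puts h in front of the old arguments.\<close>

lemma deriv_form_Suc:
  "deriv_form (Suc k) f x v =
    (\<Sum>i\<in>UNIV. v 0 $ i * (\<Sum>is\<in>{is. length is = k}. partial_deriv i (iterated_partial is f) x * (\<Prod>j<k. v (Suc j) $ (is ! j))))"
proof -
  have eq: "{is :: 'n list. length is = Suc k} = (\<lambda>(i, is). i # is) ` (UNIV \<times> {is. length is = k})"
    by (auto simp: length_Suc_conv image_iff)
  have "deriv_form (Suc k) f x v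
      = (\<Sum>(i, is)\<in>UNIV \<times> {is. length is = k}. partial_deriv i (iterated_partial is f) x
          * (v 0 $ i * (\<Prod>j<k. v (Suc j) $ (is ! j))))"
    unfolding deriv_form_def eq
    by (subst sum.reindex) (auto simp: inj_on_def prod.lessThan_Suc_shift split_beta simp del: prod.lessThan_Suc intro!: sum.cong)
  also have "\<dots> = (\<Sum>i\<in>UNIV. \<Sum>is\<in>{is. length is = k}. partial_deriv i (iterated_partial is f) x
          * (v 0 $ i * (\<Prod>j<k. v (Suc j) $ (is ! j))))"
    by (rule sum.cartesian_product[symmetric])
  finally show ?thesis by (simp add: sum_distrib_left mult_ac)
qed

lemma deriv_form_uminus: "deriv_form (Suc k) f x (v(0 := - v 0)) = - deriv_form (Suc k) f x v"
  by (simp add: deriv_form_Suc sum_negf)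

lemma bdd_above_deriv_form:
  fixes f :: "real^'n::finite \<Rightarrow> real"
  shows "bdd_above (deriv_form k f x ` unit_tuples k)"
proof (rule bdd_aboveI2)
  fix v :: "nat \<Rightarrow> real^'n" assume v: "v \<in> unit_tuples k"
  have "(\<Prod>j<k. \<bar>v j $ (is ! j)\<bar>) \<le> 1" for "is" :: "'n list"
  proof (rule prod_le_1)
    fix j assume "j \<in> {..<k}"
    then show "0 \<le> \<bar>v j $ (is ! j)\<bar> \<and> \<bar>v j $ (is ! j)\<bar> \<le> 1"
      using component_le_norm_cart[of "v j" "is ! j"] v by auto
  qed
  then have "\<bar>iterated_partial is f x * (\<Prod>j<k. v j $ (is ! j))\<bar> \<le> \<bar>iterated_partial is f x\<bar>" for "is"
    by (simp add: abs_mult abs_prod mult_left_le)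
  then show "deriv_form k f x v \<le> (\<Sum>is\<in>{is. length is = k}. \<bar>iterated_partial is f x\<bar>)"
    unfolding deriv_form_def by (intro sum_mono) (meson abs_le_D1)
qed

lemma deriv_form_le_op_norm:
  assumes "v \<in> unit_tuples k" shows "deriv_form k f x v \<le> op_norm k f x"
  unfolding op_norm_def by (rule cSUP_upper[OF assms bdd_above_deriv_form])

text \<open>Negating one argument negates the form. This needs at least one argument: at order 0 the
  supremum is the value of \<open>f\<close> itself, sign included, hence the orders written with
  \<open>Suc\<close>.\<close>

lemma abs_deriv_form_le_op_norm:
  assumes "v \<in> unit_tuples (Suc k)" shows "\<bar>deriv_form (Suc k) f x v\<bar> \<le> op_norm (Suc k) f x"
proof (rule abs_leI)
  have "v(0 := - v 0) \<in> unit_tuples (Suc k)" using assms by auto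
  from deriv_form_le_op_norm[OF this, of f x] show "- deriv_form (Suc k) f x v \<le> op_norm (Suc k) f x"
    by (simp add: deriv_form_uminus)
qed (rule deriv_form_le_op_norm[OF assms])

lemma unit_tuples_nonempty: "(\<lambda>_. axis i 1) \<in> unit_tuples k"
  by simp

lemma op_norm_Suc_nonneg: "0 \<le> op_norm (Suc k) f x"
  using abs_deriv_form_le_op_norm[OF unit_tuples_nonempty, where f=f and x=x] abs_ge_zero order_trans by blast

lemma C_on_iterated_partial:
  "C_on (n + length is) G f \<Longrightarrow> C_on n G (iterated_partial is f)"
  by (induction "is" arbitrary: n) (auto, metis C_on.simps(2) add_Suc)

lemma continuous_on_deriv_form:
  assumes "C_on k G f" shows "continuous_on G (\<lambda>x. deriv_form k f x v)"
  unfolding deriv_form_def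
  by (intro continuous_intros) (use C_on_iterated_partial[of 0 _ G f] assms in auto)

text \<open>Testing the gradient against its own direction writes its norm as a value of the next
  derivative form, with that direction as an extra unit argument.\<close>

lemma deriv_form_C1:
  assumes "open G" and f: "C_on (Suc k) G f" and v: "v \<in> unit_tuples k"
  shows "C_on (Suc 0) G (\<lambda>x. deriv_form k f x v)"
    and "\<And>x. x \<in> G \<Longrightarrow> norm (grad (\<lambda>x. deriv_form k f x v) x) \<le> op_norm (Suc k) f x"
proof -
  have ip: "C_on (Suc 0) G (iterated_partial is f)" if "length is = k" for "is"
    by (rule C_on_iterated_partial) (use f that in simp)
  have eq: "(\<lambda>x. deriv_form k f x v)
      = (\<lambda>x. \<Sum>is\<in>{is. length is = k}. iterated_partial is f x * (\<Prod>j<k. v j $ (is ! j)))"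
    by (simp add: deriv_form_def)
  show "C_on (Suc 0) G (\<lambda>x. deriv_form k f x v)"
    unfolding eq by (intro C_on_sum C_on_mult C_on_const assms(1) ip) simp
  fix x assume x: "x \<in> G"
  have D: "((\<lambda>x. deriv_form k f x v) has_derivative
      (\<lambda>h. \<Sum>is\<in>{is. length is = k}. (grad (iterated_partial is f) x \<bullet> h) * (\<Prod>j<k. v j $ (is ! j)))) (at x)"
    unfolding eq
    by (intro has_derivative_sum has_derivative_mult_left C_on_Suc_derivative[OF ip x]) simp
  have "grad (\<lambda>x. deriv_form k f x v) x \<bullet> h = deriv_form (Suc k) f x (case_nat h v)" for h
  proof -
    have "(\<lambda>x. deriv_form k f x v) differentiable (at x)" using D by (auto simp: differentiable_def)
    from has_derivative_unique[OF has_derivative_grad[OF this] D]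
    have "grad (\<lambda>x. deriv_form k f x v) x \<bullet> h
      = (\<Sum>is\<in>{is. length is = k}. (grad (iterated_partial is f) x \<bullet> h) * (\<Prod>j<k. v j $ (is ! j)))"
      by (rule fun_cong)
    also have "\<dots> = (\<Sum>is\<in>{is. length is = k}. \<Sum>i\<in>UNIV. h $ i *
        (partial_deriv i (iterated_partial is f) x * (\<Prod>j<k. v j $ (is ! j))))"
      by (simp add: inner_vec_def grad_def sum_distrib_left sum_distrib_right mult_ac)
    also have "\<dots> = deriv_form (Suc k) f x (case_nat h v)"
      by (subst sum.swap) (simp add: deriv_form_Suc sum_distrib_left)
    finally show ?thesis .
  qed
  note gd = this
  show "norm (grad (\<lambda>x. deriv_form k f x v) x) \<le> op_norm (Suc k) f x"
  proof (cases "grad (\<lambda>x. deriv_form k f x v) x = 0")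
    \<comment> \<open>A zero gradient has no direction: \<open>sgn 0\<close> is not a unit
      vector.\<close>
    case True
    then show ?thesis by (simp add: op_norm_Suc_nonneg)
  next
    case False
    define g where "g = grad (\<lambda>x. deriv_form k f x v) x"
    have "norm g = g \<bullet> sgn g"
      using False by (simp add: g_def sgn_div_norm power2_norm_eq_inner[symmetric] power2_eq_square)
    also have "\<dots> = deriv_form (Suc k) f x (case_nat (sgn g) v)" unfolding g_def by (rule gd)
    also have "\<dots> \<le> op_norm (Suc k) f x"
      by (rule deriv_form_le_op_norm) (use v False in \<open>auto simp: g_def norm_sgn split: nat.split\<close>)
    finally show ?thesis by (simp add: g_def)
  qed
qed

text \<open>The form is continuous in its arguments, so tuples from a countable dense subset of the
  sphere exhaust the supremum. One sequence works for all \<open>f\<close> and all points, which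
  makes measurability and a sequence of finite maxima possible.\<close>

lemma dense_unit_tuples:
  obtains V :: "nat \<Rightarrow> nat \<Rightarrow> real^'n::finite"
  where "\<And>m. V m \<in> unit_tuples k"
    "\<And>f x y. y < op_norm k f x \<Longrightarrow> \<exists>m. y < deriv_form k f x (V m)"
proof -
  obtain D where D: "countable D" "D \<subseteq> sphere (0::real^'n) 1" "sphere 0 1 \<subseteq> closure D"
    by (rule separable)
  define P where "P = PiE {..<k} (\<lambda>_. D)"
  have "axis undefined 1 \<in> closure D" using D(3) by (auto simp: subset_iff)
  then have "D \<noteq> {}" by auto
  then have P: "countable P" "P \<noteq> {}"
    unfolding P_def using D(1) by (auto intro: countable_PiE simp: PiE_eq_empty_iff)
  show ?thesis
  proof (rule that[of "from_nat_into P"])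
    show "from_nat_into P m \<in> unit_tuples k" for m
      using from_nat_into[OF P(2), of m] D(2) by (auto simp: P_def PiE_iff subset_iff)
    fix f :: "real^'n \<Rightarrow> real" and x y assume "y < op_norm k f x"
    moreover have ne: "unit_tuples k \<noteq> ({} :: (nat \<Rightarrow> real^'n) set)"
    proof -
      have "(\<lambda>_. axis undefined 1) \<in> (unit_tuples k :: (nat \<Rightarrow> real^'n) set)"
        by (rule unit_tuples_nonempty)
      then show ?thesis by (intro ex_in_conv[THEN iffD1] exI)
    qed
    ultimately have "\<exists>v\<in>unit_tuples k. y < deriv_form k f x v"
      unfolding op_norm_def less_cSUP_iff[OF ne bdd_above_deriv_form] by simp
    then obtain v where v: "v \<in> unit_tuples k" "y < deriv_form k f x v" by blast
    have "\<forall>j. \<exists>F. j < k \<longrightarrow> (\<forall>n. F n \<in> D) \<and> F \<longlonglongrightarrow> v j"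
      using v(1) D(3) by (auto simp: subset_iff closure_sequential[symmetric])
    then obtain F where F: "\<And>j n. j < k \<Longrightarrow> F j n \<in> D" "\<And>j. j < k \<Longrightarrow> F j \<longlonglongrightarrow> v j"
      by metis
    have "(\<lambda>n. deriv_form k f x (\<lambda>j\<in>{..<k}. F j n)) \<longlonglongrightarrow> deriv_form k f x v"
      unfolding deriv_form_def using F(2) by (auto intro!: tendsto_intros)
    then have "\<forall>\<^sub>F n in sequentially. y < deriv_form k f x (\<lambda>j\<in>{..<k}. F j n)"
      using v(2) by (rule order_tendstoD)
    then obtain n where n: "y < deriv_form k f x (\<lambda>j\<in>{..<k}. F j n)"
      by (auto simp: eventually_sequentially)
    have "(\<lambda>j\<in>{..<k}. F j n) \<in> P" using F(1) by (auto simp: P_def)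
    then show "\<exists>m. y < deriv_form k f x (from_nat_into P m)"
      using n from_nat_into_surj[OF P(1)] by metis
  qed
qed

section \<open>Soft maxima and approximation of operator norms\<close>

text \<open>Log-sum-exp of m + 1 functions with sharpness \<open>(m + 1)^2\<close>: more terms and
  higher sharpness in the same limit. The excess over the maximum,
  \<open>ln (m + 1) / (m + 1)^2\<close>, vanishes already by the crude bound
  \<open>ln (m + 1) \<le> m + 1\<close>.\<close>

definition softmax :: "(nat \<Rightarrow> 'a \<Rightarrow> real) \<Rightarrow> nat \<Rightarrow> 'a \<Rightarrow> real" where
  "softmax A m x = ln (\<Sum>i\<le>m. exp ((real (Suc m))\<^sup>2 * A i x)) / (real (Suc m))\<^sup>2"

lemma sum_exp_pos: "(\<Sum>i\<le>m. exp (a i)) > (0::real)" for m :: nat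
  by (intro sum_pos) auto

lemma softmax_ge: "i \<le> m \<Longrightarrow> A i x \<le> softmax A m x"
proof -
  assume i: "i \<le> m"
  define q where "q = (real (Suc m))\<^sup>2"
  have q: "q > 0" by (simp add: q_def)
  have "exp (q * A i x) \<le> (\<Sum>i\<le>m. exp (q * A i x))"
    using i by (intro member_le_sum) auto
  then have "q * A i x \<le> ln (\<Sum>i\<le>m. exp (q * A i x))"
    using sum_exp_pos[of "\<lambda>i. q * A i x" m] by (subst ln_ge_iff) auto
  then show ?thesis using q unfolding softmax_def q_def[symmetric] by (simp add: field_simps)
qed

lemma softmax_le:
  assumes "\<And>i. A i x \<le> a" shows "softmax A m x \<le> a + 1 / real (Suc m)"
proof -
  define q where "q = (real (Suc m))\<^sup>2"
  have q: "q > 0" by (simp add: q_def)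
  have "(\<Sum>i\<le>m. exp (q * A i x)) \<le> (\<Sum>i\<le>m. exp (q * a))"
    using assms q by (intro sum_mono) simp
  also have "\<dots> = real (Suc m) * exp (q * a)" by simp
  finally have "ln (\<Sum>i\<le>m. exp (q * A i x)) \<le> ln (real (Suc m) * exp (q * a))"
    using sum_exp_pos[of "\<lambda>i. q * A i x" m] by (intro ln_mono) auto
  also have "\<dots> = ln (real (Suc m)) + q * a" by (simp add: ln_mult)
  also have "\<dots> \<le> real (Suc m) + q * a" using ln_le_minus_one[of "real (Suc m)"] by simp
  finally have "softmax A m x \<le> (real (Suc m) + q * a) / q"
    using q unfolding softmax_def q_def[symmetric] by (simp add: divide_right_mono)
  also have "\<dots> = a + 1 / real (Suc m)"
    by (simp add: q_def power2_eq_square field_simps del: of_nat_Suc)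
  finally show ?thesis .
qed

lemma softmax_tendsto:
  assumes le: "\<And>i. A i x \<le> a" and sup: "\<And>y. y < a \<Longrightarrow> \<exists>i. y < A i x"
  shows "(\<lambda>m. softmax A m x) \<longlonglongrightarrow> a"
proof (rule order_tendstoI)
  fix y assume "y < a"
  then obtain i where "y < A i x" using sup by blast
  then have "\<forall>m\<ge>i. y < softmax A m x" using softmax_ge[of i _ A x] by (meson less_le_trans)
  then show "\<forall>\<^sub>F m in sequentially. y < softmax A m x" by (auto simp: eventually_sequentially)
next
  fix y assume "a < y"
  have "(\<lambda>m. a + 1 / real (Suc m)) \<longlonglongrightarrow> a + 0"
    by (intro tendsto_intros LIMSEQ_Suc[OF lim_1_over_n])
  then have "\<forall>\<^sub>F m in sequentially. a + 1 / real (Suc m) < y"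
    using \<open>a < y\<close> by (intro order_tendstoD) auto
  then show "\<forall>\<^sub>F m in sequentially. softmax A m x < y"
    by eventually_elim (use softmax_le[of A x a, OF le] in \<open>auto intro: le_less_trans\<close>)
qed

lemma continuous_on_softmax:
  assumes "\<And>i. continuous_on G (A i)" shows "continuous_on G (softmax A m)"
  unfolding softmax_def
  by (intro continuous_intros assms) (auto simp: less_imp_neq[OF sum_exp_pos, symmetric])

text \<open>The gradient of the soft maximum is a convex combination of the gradients.\<close>
lemma softmax_C1:
  assumes "open G" and A: "\<And>i. C_on (Suc 0) G (A i)"
  shows "C_on (Suc 0) G (softmax A m)"
    and "\<And>x r. x \<in> G \<Longrightarrow> (\<And>i. norm (grad (A i) x) \<le> r) \<Longrightarrow> norm (grad (softmax A m) x) \<le> r"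
proof -
  define q where "q = (real (Suc m))\<^sup>2"
  have q: "q > 0" by (simp add: q_def)
  define E where "E i x = exp (q * A i x)" for i x
  define Z where "Z x = (\<Sum>i\<le>m. E i x)" for x
  have Z: "Z x > 0" for x unfolding Z_def E_def by (rule sum_exp_pos)
  have dE: "((\<lambda>s. exp (q * s)) has_real_derivative q * exp (q * s)) (at s)" for s
    by (auto intro!: derivative_eq_intros)
  have E: "C_on (Suc 0) G (E i)" "\<And>x. x \<in> G \<Longrightarrow> grad (E i) x = (q * E i x) *\<^sub>R grad (A i) x" for i
    unfolding E_def[abs_def]
    by (rule C_on_compose_real[OF assms(1) A dE]; auto intro!: continuous_intros)+
  have ZC: "C_on (Suc 0) G Z"
    unfolding Z_def[abs_def] by (intro C_on_sum assms(1) E)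
  have gZ: "grad Z x = (\<Sum>i\<le>m. (q * E i x) *\<^sub>R grad (A i) x)" if "x \<in> G" for x
    unfolding Z_def[abs_def] using E(1) that by (subst grad_sum) (auto simp: E(2))
  have dL: "((\<lambda>s. ln s / q) has_real_derivative 1 / (q * Z x)) (at (Z x))" for x
    using Z[of x] q by (auto intro!: derivative_eq_intros simp: field_simps)
  have cL: "continuous_on (Z ` G) (\<lambda>s. 1 / (q * s))"
    using Z q by (intro continuous_intros) (auto simp: less_imp_neq[OF Z, symmetric])
  have eq: "softmax A m = (\<lambda>x. ln (Z x) / q)"
    by (simp add: softmax_def[abs_def] Z_def E_def q_def)
  show "C_on (Suc 0) G (softmax A m)"
    unfolding eq by (rule C_on_compose_real(1)[OF assms(1) ZC dL cL])
  fix x r assume x: "x \<in> G" and r: "\<And>i. norm (grad (A i) x) \<le> r"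
  have "grad (softmax A m) x = (1 / (q * Z x)) *\<^sub>R grad Z x"
    unfolding eq by (rule C_on_compose_real(2)[OF assms(1) ZC dL cL x])
  then have "norm (grad (softmax A m) x) = 1 / (q * Z x) * norm (\<Sum>i\<le>m. (q * E i x) *\<^sub>R grad (A i) x)"
    using q Z[of x] by (simp add: gZ[OF x])
  also have "\<dots> \<le> 1 / (q * Z x) * (\<Sum>i\<le>m. (q * E i x) * r)"
  proof (intro mult_left_mono sum_norm_le)
    fix i
    show "norm ((q * E i x) *\<^sub>R grad (A i) x) \<le> (q * E i x) * r"
      using q r[of i] by (simp add: E_def)
  qed (use q Z[of x] in simp)
  also have "\<dots> = r"
    using q Z[of x] by (simp add: Z_def flip: sum_distrib_left sum_distrib_right)
  finally show "norm (grad (softmax A m) x) \<le> r" .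
qed

text \<open>One family serves two purposes: continuity alone yields measurability of the operator
  norm, and with one more derivative of \<open>f\<close> the approximants are \<open>C^1\<close>
  with controlled gradients. Hence the conditional conclusions.\<close>

lemma op_norm_approximation:
  fixes f :: "real^'n::finite \<Rightarrow> real"
  assumes "open G" and f: "C_on (Suc k) G f"
  obtains h :: "nat \<Rightarrow> real^'n \<Rightarrow> real"
  where "\<And>m. continuous_on G (h m)"
    "\<And>m x. \<bar>h m x\<bar> \<le> op_norm (Suc k) f x + 1 / real (Suc m)"
    "\<And>x. (\<lambda>m. h m x) \<longlonglongrightarrow> op_norm (Suc k) f x"
    "\<And>m. C_on (Suc (Suc k)) G f \<Longrightarrow> C_on (Suc 0) G (h m)"
    "\<And>m x. C_on (Suc (Suc k)) G f \<Longrightarrow> x \<in> G \<Longrightarrow> norm (grad (h m) x) \<le> op_norm (Suc (Suc k)) f x"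
proof -
  obtain V :: "nat \<Rightarrow> nat \<Rightarrow> real^'n" where V: "\<And>m. V m \<in> unit_tuples (Suc k)"
    "\<And>f x y. y < op_norm (Suc k) f x \<Longrightarrow> \<exists>m. y < deriv_form (Suc k) f x (V m)"
    by (rule dense_unit_tuples[of "Suc k"]) (rule that)
  define A where "A m x = deriv_form (Suc k) f x (V m)" for m x
  have A: "\<bar>A m x\<bar> \<le> op_norm (Suc k) f x" for m x
    unfolding A_def by (rule abs_deriv_form_le_op_norm[OF V(1)])
  have A': "A m x \<le> op_norm (Suc k) f x" for m x using A[of m x] by simp
  have h: "\<bar>softmax A m x\<bar> \<le> op_norm (Suc k) f x + 1 / real (Suc m)" for m x
  proof (rule abs_leI)
    show "softmax A m x \<le> op_norm (Suc k) f x + 1 / real (Suc m)" by (rule softmax_le) (rule A')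
    \<comment> \<open>A very negative soft maximum is excluded by a single entry, which it cannot
      fall below.\<close>
    have "- softmax A m x \<le> - A 0 x" using softmax_ge[of 0 m A x] by simp
    also have "\<dots> \<le> op_norm (Suc k) f x" using A[of 0 x] by simp
    also have "\<dots> \<le> op_norm (Suc k) f x + 1 / real (Suc m)" by simp
    finally show "- softmax A m x \<le> op_norm (Suc k) f x + 1 / real (Suc m)" .
  qed
  show ?thesis
  proof (rule that[of "softmax A"])
    show "continuous_on G (softmax A m)" for m
      unfolding A_def[abs_def] by (intro continuous_on_softmax continuous_on_deriv_form f)
    show "(\<lambda>m. softmax A m x) \<longlonglongrightarrow> op_norm (Suc k) f x" for x
      by (rule softmax_tendsto, rule A') (use V(2) in \<open>auto simp: A_def\<close>)
    assume f': "C_on (Suc (Suc k)) G f"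
    note AC = deriv_form_C1[OF assms(1) f' V(1)]
    show "C_on (Suc 0) G (softmax A m)" for m
      by (rule softmax_C1(1)[OF assms(1)]) (unfold A_def[abs_def], rule AC(1))
    show "norm (grad (softmax A m) x) \<le> op_norm (Suc (Suc k)) f x" if "x \<in> G" for m x
      by (rule softmax_C1(2)[OF assms(1) _ that]; unfold A_def[abs_def], rule AC) (rule that)
  qed (rule h)
qed

section \<open>Concentration\<close>

context log_Sobolev_space
begin

lemma measurable_op_norm:
  assumes "C_on (Suc k) G f" shows "op_norm (Suc k) f \<in> borel_measurable M"
proof -
  obtain h where h: "\<And>m. continuous_on G (h m)" "\<And>x. (\<lambda>m. h m x) \<longlonglongrightarrow> op_norm (Suc k) f x"
    by (rule op_norm_approximation[OF open_G assms]) (rule that)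
  show ?thesis
    by (rule borel_measurable_LIMSEQ_real[OF h(2)]) (rule measurable_continuous[OF h(1)])
qed

text \<open>The moment estimate is applied to the \<open>C^1\<close> soft maxima and carried to
  their limit by Fatou's lemma. Their second moments exceed that of the operator norm only by an
  error that tends to 0.\<close>

lemma op_norm_moment_growth:
  assumes f: "C_on (Suc (Suc k)) G f" and int2: "integrable M (\<lambda>x. (op_norm (Suc k) f x)\<^sup>2)"
    and intp: "integrable M (\<lambda>x. op_norm (Suc (Suc k)) f x powr p)" and "p \<ge> 2"
  shows "integrable M (\<lambda>x. op_norm (Suc k) f x powr p)"
    and "(\<integral>x. op_norm (Suc k) f x powr p \<partial>M) powr (2 / p)
      \<le> (\<integral>x. (op_norm (Suc k) f x)\<^sup>2 \<partial>M)
        + c * (p - 2) * (\<integral>x. op_norm (Suc (Suc k)) f x powr p \<partial>M) powr (2 / p)"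
proof -
  have [measurable]: "op_norm (Suc k) f \<in> borel_measurable M" and wm: "op_norm (Suc (Suc k)) f \<in> borel_measurable M"
    using f by (auto intro: measurable_op_norm C_on_Suc_imp simp del: C_on.simps)
  define R where "R = c * (p - 2) * (\<integral>x. op_norm (Suc (Suc k)) f x powr p \<partial>M) powr (2 / p)"
  define S where "S = (\<integral>x. (op_norm (Suc k) f x)\<^sup>2 \<partial>M)"
  have RS: "R \<ge> 0" "S \<ge> 0" using c_pos \<open>p \<ge> 2\<close> by (auto simp: R_def S_def)
  define e where "e m = 1 / real (Suc m)" for m
  have e: "e m > 0" for m by (simp add: e_def)
  have e0: "e \<longlonglongrightarrow> 0" unfolding e_def by (rule LIMSEQ_Suc) (rule lim_1_over_n)
  obtain h where hc: "\<And>m. continuous_on G (h m)"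
    and hle: "\<And>m x. \<bar>h m x\<bar> \<le> op_norm (Suc k) f x + 1 / real (Suc m)"
    and hlim: "\<And>x. (\<lambda>m. h m x) \<longlonglongrightarrow> op_norm (Suc k) f x"
    and hC: "\<And>m. C_on (Suc (Suc k)) G f \<Longrightarrow> C_on (Suc 0) G (h m)"
    and hg: "\<And>m x. C_on (Suc (Suc k)) G f \<Longrightarrow> x \<in> G \<Longrightarrow> norm (grad (h m) x) \<le> op_norm (Suc (Suc k)) f x"
    by (rule op_norm_approximation[OF open_G C_on_Suc_imp[OF f]]) (rule that)
  have [measurable]: "h m \<in> borel_measurable M" for m by (rule measurable_continuous[OF hc])
  have hsq: "(h m x)\<^sup>2 \<le> (1 + e m) * (op_norm (Suc k) f x)\<^sup>2 + (e m + (e m)\<^sup>2)" for m x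
  proof -
    have "\<bar>h m x\<bar>\<^sup>2 \<le> (op_norm (Suc k) f x + e m)\<^sup>2"
      using hle[of m x] by (intro power_mono) (auto simp: e_def)
    moreover have "0 \<le> e m * (op_norm (Suc k) f x - 1)\<^sup>2" using e[of m] by simp
    ultimately show ?thesis by (simp add: power2_eq_square algebra_simps)
  qed
  have inth: "integrable M (\<lambda>x. (h m x)\<^sup>2)" for m
  proof (rule Bochner_Integration.integrable_bound)
    show "integrable M (\<lambda>x. (1 + e m) * (op_norm (Suc k) f x)\<^sup>2 + (e m + (e m)\<^sup>2))"
      using int2 by simp
    show "AE x in M. norm ((h m x)\<^sup>2) \<le> norm ((1 + e m) * (op_norm (Suc k) f x)\<^sup>2 + (e m + (e m)\<^sup>2))"
      using order_trans[OF hsq abs_ge_self] by simp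
  qed measurable
  note mg = moment_growth[OF hC[OF f] inth hg[OF f] wm intp \<open>p \<ge> 2\<close>]
  have vb: "(\<integral>x. \<bar>h m x\<bar> powr p \<partial>M) \<le> ((1 + e m) * S + (e m + (e m)\<^sup>2) + R) powr (p / 2)" for m
  proof -
    have "(\<integral>x. \<bar>h m x\<bar> powr p \<partial>M) powr (2 / p) \<le> (\<integral>x. (h m x)\<^sup>2 \<partial>M) + R"
      unfolding R_def by (rule mg(2))
    also have "(\<integral>x. (h m x)\<^sup>2 \<partial>M) \<le> (\<integral>x. (1 + e m) * (op_norm (Suc k) f x)\<^sup>2 + (e m + (e m)\<^sup>2) \<partial>M)"
      by (rule integral_mono) (use inth int2 hsq in auto)
    also have "\<dots> = (1 + e m) * S + (e m + (e m)\<^sup>2)" using int2 by (simp add: S_def)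
    finally have "((\<integral>x. \<bar>h m x\<bar> powr p \<partial>M) powr (2 / p)) powr (p / 2)
        \<le> ((1 + e m) * S + (e m + (e m)\<^sup>2) + R) powr (p / 2)"
      using \<open>p \<ge> 2\<close> by (intro powr_mono2) auto
    then show ?thesis using \<open>p \<ge> 2\<close> by (simp add: powr_powr)
  qed
  have lim: "(\<lambda>m. \<bar>h m x\<bar> powr p) \<longlonglongrightarrow> op_norm (Suc k) f x powr p" for x
  proof -
    have "(\<lambda>m. \<bar>h m x\<bar> powr p) \<longlonglongrightarrow> \<bar>op_norm (Suc k) f x\<bar> powr p"
      using \<open>p \<ge> 2\<close> by (intro tendsto_powr' tendsto_intros hlim) auto
    then show ?thesis by (simp add: op_norm_Suc_nonneg)
  qed
  have limA: "(\<lambda>m. ((1 + e m) * S + (e m + (e m)\<^sup>2) + R) powr (p / 2))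
      \<longlonglongrightarrow> ((1 + 0) * S + (0 + 0\<^sup>2) + R) powr (p / 2)"
    using \<open>p \<ge> 2\<close> RS e by (intro tendsto_powr' tendsto_intros e0) (auto simp: less_imp_le intro!: always_eventually add_nonneg_nonneg)
  note F = Fatou_bound[OF mg(1) _ lim vb limA]
  show "integrable M (\<lambda>x. op_norm (Suc k) f x powr p)" using F(1) by simp
  have "(\<integral>x. op_norm (Suc k) f x powr p \<partial>M) powr (2 / p) \<le> ((S + R) powr (p / 2)) powr (2 / p)"
    using F(2) \<open>p \<ge> 2\<close> by (intro powr_mono2) auto
  also have "\<dots> = S + R" using RS \<open>p \<ge> 2\<close> by (simp add: powr_powr)
  finally show "(\<integral>x. op_norm (Suc k) f x powr p \<partial>M) powr (2 / p)
      \<le> (\<integral>x. (op_norm (Suc k) f x)\<^sup>2 \<partial>M)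
        + c * (p - 2) * (\<integral>x. op_norm (Suc (Suc k)) f x powr p \<partial>M) powr (2 / p)"
    by (simp add: R_def S_def)
qed

text \<open>Descent from order d. The weight \<open>(c * p) ^ j\<close> makes the recursion
  additive: each step down contributes one second-moment term of size at most \<open>r\<close>, and
  \<open>d - j + 1\<close> counts the terms so far.\<close>

lemma op_norm_moment_chain:
  assumes f: "C_on d G f" and "p \<ge> 2" and j: "1 \<le> j" "j \<le> d"
    and a: "\<And>k. 1 \<le> k \<Longrightarrow> k < d \<Longrightarrow> integrable M (\<lambda>x. (op_norm k f x)\<^sup>2)"
      "\<And>k. 1 \<le> k \<Longrightarrow> k < d \<Longrightarrow> (c * p) ^ k * (\<integral>x. (op_norm k f x)\<^sup>2 \<partial>M) \<le> r"
    and b: "AE x in M. op_norm d f x \<le> b" "b \<ge> 0" "(c * p) ^ d * b\<^sup>2 \<le> r"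
  shows "integrable M (\<lambda>x. op_norm j f x powr p) \<and>
    (c * p) ^ j * (\<integral>x. op_norm j f x powr p \<partial>M) powr (2 / p) \<le> real (d - j + 1) * r"
  using j(2,1)
proof (induction j rule: inc_induct)
  case base
  then obtain l where l: "d = Suc l" by (cases d) auto
  have [measurable]: "op_norm d f \<in> borel_measurable M"
    using measurable_op_norm f unfolding l by blast
  have bd: "AE x in M. op_norm d f x powr p \<le> b powr p"
    using b(1) by eventually_elim (use \<open>p \<ge> 2\<close> in \<open>auto simp: l op_norm_Suc_nonneg intro!: powr_mono2\<close>)
  then have int: "integrable M (\<lambda>x. op_norm d f x powr p)"
    by (intro integrable_const_bound[of _ "b powr p"]) auto
  have "(\<integral>x. op_norm d f x powr p \<partial>M) \<le> (\<integral>x. b powr p \<partial>M)"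
    by (rule integral_mono_AE) (use int bd in auto)
  then have "(\<integral>x. op_norm d f x powr p \<partial>M) powr (2 / p) \<le> (b powr p) powr (2 / p)"
    using \<open>p \<ge> 2\<close> by (intro powr_mono2) (auto intro: Bochner_Integration.integral_nonneg)
  also have "\<dots> = b\<^sup>2" using \<open>p \<ge> 2\<close> b(2) by (simp add: powr_powr)
  finally have "(c * p) ^ d * (\<integral>x. op_norm d f x powr p \<partial>M) powr (2 / p) \<le> (c * p) ^ d * b\<^sup>2"
    using c_pos \<open>p \<ge> 2\<close> by (intro mult_left_mono) auto
  with int b(3) show ?case by simp
next
  case (step n)
  then obtain l where l: "n = Suc l" by (cases n) auto
  have IH: "integrable M (\<lambda>x. op_norm (Suc n) f x powr p)"
    "(c * p) ^ Suc n * (\<integral>x. op_norm (Suc n) f x powr p \<partial>M) powr (2 / p) \<le> real (d - Suc n + 1) * r"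
    using step.IH by auto
  have fn: "C_on (Suc (Suc l)) G f"
    by (rule C_on_mono[OF f]) (use step.hyps l in simp)
  have n: "1 \<le> n" "n < d" using step by auto
  note g = op_norm_moment_growth[OF fn a(1)[OF n, unfolded l] IH(1)[unfolded l] \<open>p \<ge> 2\<close>]
  define N where "N = (\<integral>x. op_norm (Suc n) f x powr p \<partial>M) powr (2 / p)"
  have N: "N \<ge> 0" by (simp add: N_def)
  have "c * (p - 2) * N \<le> c * p * N"
    \<comment> \<open>Replacing p - 2 by p makes the factor match one step of the weight
      \<open>(c * p) ^ n\<close>.\<close>
    using c_pos N by (intro mult_right_mono) auto
  then have "(\<integral>x. op_norm n f x powr p \<partial>M) powr (2 / p) \<le> (\<integral>x. (op_norm n f x)\<^sup>2 \<partial>M) + c * p * N"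
    using g(2) unfolding N_def l by linarith
  then have "(c * p) ^ n * (\<integral>x. op_norm n f x powr p \<partial>M) powr (2 / p)
      \<le> (c * p) ^ n * ((\<integral>x. (op_norm n f x)\<^sup>2 \<partial>M) + c * p * N)"
    using c_pos \<open>p \<ge> 2\<close> by (intro mult_left_mono) auto
  also have "\<dots> = (c * p) ^ n * (\<integral>x. (op_norm n f x)\<^sup>2 \<partial>M) + (c * p) ^ Suc n * N"
    by (simp add: algebra_simps)
  also have "\<dots> \<le> r + real (d - Suc n + 1) * r"
    using a(2)[OF n] IH(2) unfolding N_def by (rule add_mono)
  also have "\<dots> = real (d - n + 1) * r"
    using n(2) by (simp add: algebra_simps of_nat_diff)
  finally show ?case using g(1) unfolding l by simp
qed

lemma tail_bound:
  assumes f: "C_on d G f" and int: "integrable M f" and mean: "(\<integral>x. f x \<partial>M) = 0"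
    and "p \<ge> 2" "d \<ge> 1" "t > 0"
    and a: "\<And>k. 1 \<le> k \<Longrightarrow> k < d \<Longrightarrow> integrable M (\<lambda>x. (op_norm k f x)\<^sup>2)"
      "\<And>k. 1 \<le> k \<Longrightarrow> k < d \<Longrightarrow> (c * p) ^ k * (\<integral>x. (op_norm k f x)\<^sup>2 \<partial>M) \<le> r"
    and b: "AE x in M. op_norm d f x \<le> b" "b \<ge> 0" "(c * p) ^ d * b\<^sup>2 \<le> r"
    and r: "real d * r \<le> (t / exp 1)\<^sup>2"
  shows "measure M {x \<in> space M. \<bar>f x\<bar> \<ge> t} \<le> exp (- p)"
proof -
  have f1: "C_on (Suc 0) G f" by (rule C_on_mono[OF f]) (use \<open>d \<ge> 1\<close> in simp)
  define N where "N = (\<integral>x. op_norm (Suc 0) f x powr p \<partial>M) powr (2 / p)"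
  have ch: "integrable M (\<lambda>x. op_norm (Suc 0) f x powr p)" "c * p * N \<le> real d * r"
    using op_norm_moment_chain[OF f \<open>p \<ge> 2\<close> _ _ a b, of "Suc 0"] \<open>d \<ge> 1\<close> by (auto simp: N_def)
  have wm: "op_norm (Suc 0) f \<in> borel_measurable M" by (rule measurable_op_norm[OF f1])
  have w: "norm (grad f x) \<le> op_norm (Suc 0) f x" if "x \<in> G" for x
  proof -
    \<comment> \<open>At order 0 the form is \<open>f\<close> itself, so the gradient bound for
      forms covers the gradient of \<open>f\<close>.\<close>
    have "deriv_form 0 f x v = f x" for x v by (simp add: deriv_form_def)
    then show ?thesis using deriv_form_C1(2)[OF open_G f1 _ that, of "\<lambda>_. 0"] by simp
  qed
  have sq: "op_norm (Suc 0) f x powr 2 = (op_norm (Suc 0) f x)\<^sup>2" for x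
    by (simp add: op_norm_Suc_nonneg)
  \<comment> \<open>The second moment is taken from the p-th one, which also covers d = 1, where no
    separate second-moment bound is given.\<close>
  have w2: "integrable M (\<lambda>x. (op_norm (Suc 0) f x)\<^sup>2)" "(\<integral>x. (op_norm (Suc 0) f x)\<^sup>2 \<partial>M) \<le> N"
    using moment_mono[OF wm op_norm_Suc_nonneg ch(1), of 2] \<open>p \<ge> 2\<close>
    by (auto simp: sq N_def)
  note P = Poincare[OF f1 int mean w w2(1)]
  note mg = moment_growth[OF f1 P(1) w wm ch(1) \<open>p \<ge> 2\<close>]
  \<comment> \<open>Poincare's inequality replaces the second moment of \<open>f\<close> by
    \<open>c * N\<close>. Together with the growth term this is c (p - 1) N, so order 0 contributes
    no term of its own.\<close>
  have "(\<integral>x. \<bar>f x\<bar> powr p \<partial>M) powr (2 / p) \<le> c * N + c * (p - 2) * N"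
    using mg(2) P(2) mult_left_mono[OF w2(2), of c] c_pos unfolding N_def by linarith
  also have "\<dots> \<le> c * p * N"
    using c_pos by (simp add: N_def algebra_simps)
  also have "\<dots> \<le> (t / exp 1)\<^sup>2" using ch(2) r by linarith
  finally have "((\<integral>x. \<bar>f x\<bar> powr p \<partial>M) powr (2 / p)) powr (p / 2) \<le> ((t / exp 1) powr 2) powr (p / 2)"
    using \<open>p \<ge> 2\<close> \<open>t > 0\<close> by (intro powr_mono2) auto
  then have mom: "(\<integral>x. \<bar>f x\<bar> powr p \<partial>M) \<le> (t / exp 1) powr p"
    using \<open>p \<ge> 2\<close> by (simp add: powr_powr)
  have "{x \<in> space M. \<bar>f x\<bar> \<ge> t} = {x \<in> space M. \<bar>f x\<bar> powr p \<ge> t powr p}"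
    using \<open>p \<ge> 2\<close> \<open>t > 0\<close> by (auto simp: powr_mono2) (metis abs_ge_zero not_le powr_less_mono2 zero_less_numeral order_less_le_trans)
  then have "measure M {x \<in> space M. \<bar>f x\<bar> \<ge> t} \<le> (\<integral>x. \<bar>f x\<bar> powr p \<partial>M) / t powr p"
    using integral_Markov_inequality_measure[OF mg(1) sets.top, of "t powr p"] \<open>t > 0\<close> by simp
  also have "\<dots> \<le> (t / exp 1) powr p / t powr p"
    by (intro divide_right_mono mom) simp
  also have "\<dots> = exp (- p)"
    using \<open>t > 0\<close> by (simp add: powr_divide exp_powr_real exp_minus field_simps)
  finally show ?thesis .
qed

end

section \<open>From the extended quotients to real bounds, and conclusion\<close>

text \<open>Where the quotient conventions enter: an infinite denominator makes the quotient 0,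
  against s > 0, while for X = 0 the real inequality is just T \<ge> 0.\<close>

lemma ennreal_le_quotientD:
  assumes "ennreal s \<le> ennreal T / (ennreal c * X)" "s > 0" "c > 0" "T \<ge> 0"
  shows "X \<noteq> \<infinity>" "s * c * enn2real X \<le> T"
proof -
  show X: "X \<noteq> \<infinity>"
  proof
    assume "X = \<infinity>"
    then show False using assms by (simp add: ennreal_mult_top)
  qed
  then obtain x where x: "X = ennreal x" "x \<ge> 0" by (cases X) auto
  show "s * c * enn2real X \<le> T"
  proof (cases "x = 0")
    case False
    with x have "x > 0" by simp
    then have "ennreal s \<le> ennreal (T / (c * x))"
      using assms x by (simp add: divide_ennreal flip: ennreal_mult')
    then have "s \<le> T / (c * x)" using assms \<open>x > 0\<close> by (subst (asm) ennreal_le_iff) auto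
    then show ?thesis using assms \<open>x > 0\<close> x by (simp add: field_simps)
  qed (use x assms in simp)
qed

lemma powr_bound_to_power_bound:
  assumes "s > 0" "c > 0" "k > 0" "l \<ge> 0" "t \<ge> 0" "s * c * l powr (2 / real k) \<le> t powr (2 / real k)"
  shows "(s * c) ^ k * l\<^sup>2 \<le> t\<^sup>2"
proof -
  have "(s * c * l powr (2 / real k)) ^ k \<le> (t powr (2 / real k)) ^ k"
    using assms by (intro power_mono) auto
  moreover have "(y powr (2 / real k)) ^ k = y\<^sup>2" if "y \<ge> 0" for y :: real
    using that assms(3) by (cases "y = 0") (auto simp: powr_power zero_power)
  ultimately show ?thesis using assms by (simp add: power_mult_distrib)
qed

lemma op_norm_L2:
  assumes fin: "op_norm_Lp M 2 (Suc k) f \<noteq> \<infinity>" and [measurable]: "op_norm (Suc k) f \<in> borel_measurable M"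
  shows "integrable M (\<lambda>x. (op_norm (Suc k) f x)\<^sup>2)"
    and "(\<integral>x. (op_norm (Suc k) f x)\<^sup>2 \<partial>M) = (enn2real (op_norm_Lp M 2 (Suc k) f))\<^sup>2"
proof -
  have two: "enn2real 2 = 2" using enn2real_ennreal[of 2] by simp
  define A where "A = (\<integral>\<^sup>+x. ennreal ((op_norm (Suc k) f x)\<^sup>2) \<partial>M)"
  have L: "op_norm_Lp M 2 (Suc k) f = ennpowr A (1 / 2)"
    by (simp add: op_norm_Lp_def two ennpowr_def A_def op_norm_Suc_nonneg)
  then have "A \<noteq> \<infinity>" using fin by (auto simp: ennpowr_def)
  then obtain a where a: "A = ennreal a" "a \<ge> 0" by (cases A) auto
  show int: "integrable M (\<lambda>x. (op_norm (Suc k) f x)\<^sup>2)"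
    by (rule integrableI_nonneg) (use a in \<open>auto simp: A_def\<close>)
  have "ennreal (\<integral>x. (op_norm (Suc k) f x)\<^sup>2 \<partial>M) = ennreal a"
    using nn_integral_eq_integral[OF int] a by (simp add: A_def)
  then have "(\<integral>x. (op_norm (Suc k) f x)\<^sup>2 \<partial>M) = a"
    using a by (subst (asm) ennreal_inj) auto
  moreover have "(enn2real (op_norm_Lp M 2 (Suc k) f))\<^sup>2 = a"
    using a by (simp add: L ennpowr_def powr_half_sqrt)
  ultimately show "(\<integral>x. (op_norm (Suc k) f x)\<^sup>2 \<partial>M) = (enn2real (op_norm_Lp M 2 (Suc k) f))\<^sup>2"
    by simp
qed

lemma enn2real_ennpowr: "X \<noteq> \<infinity> \<Longrightarrow> enn2real (ennpowr X a) = enn2real X powr a"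
  by (simp add: ennpowr_def)

lemma ennpowr_finite: "ennpowr X a \<noteq> \<infinity> \<Longrightarrow> X \<noteq> \<infinity>"
  by (auto simp: ennpowr_def)

theorem corollary1p11:
  fixes G :: "(real^'n::finite) set" and M :: "(real^'n) measure"
    and f :: "real^'n \<Rightarrow> real" and \<sigma> t :: real and d :: nat
  assumes "open G"
    and "prob_space M" and "sets M = sets (restrict_space borel G)"
    and "\<sigma>\<^sup>2 > 0" and "log_Sobolev G M (\<sigma>\<^sup>2)"
    and "d \<ge> 1" and "C_on d G f"
    and "integrable M f" and "(\<integral>x. f x \<partial>M) = 0"
    and "t \<ge> 0"
  shows "measure M {x \<in> space M. \<bar>f x\<bar> \<ge> t}
           \<le> (exp 1)\<^sup>2 * exp_neg (eta M \<sigma> d f t / ennreal ((real d * exp 1)\<^sup>2))"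
proof -
  interpret prob_space M by fact
  interpret log_Sobolev_space M G "\<sigma>\<^sup>2"
    by unfold_locales (use assms in auto)
  define Q where "Q = (real d * exp 1)\<^sup>2"
  have "1 \<le> real d * exp 1"
    using mult_mono[of 1 "real d" 1 "exp 1"] assms(6) by simp
  then have Q: "Q \<ge> 1" unfolding Q_def by (rule one_le_power)
  let ?\<mu> = "measure M {x \<in> space M. \<bar>f x\<bar> \<ge> t}"
  have e2: "1 \<le> (exp 1 :: real)\<^sup>2" by (rule one_le_power) simp
  have main: "?\<mu> \<le> exp (- p)" if t: "t > 0" and p: "p \<ge> 2" and \<eta>: "ennreal (p * Q) \<le> eta M \<sigma> d f t" for p
  proof -
    have pQ: "p * Q > 0" using p Q by simp
    have power: "(\<sigma>\<^sup>2 * p) ^ k * l\<^sup>2 \<le> t\<^sup>2 / Q"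
      if "k \<ge> 1" and l: "ennreal (p * Q) \<le> ennreal (t powr (2 / real k)) / (ennreal (\<sigma>\<^sup>2) * ennpowr L (2 / real k))"
        "l = enn2real L" for k L l
    proof -
      note le = ennreal_le_quotientD[OF l(1) pQ assms(4) powr_ge_zero]
      have "(p * Q * \<sigma>\<^sup>2) ^ k * l\<^sup>2 \<le> t\<^sup>2"
        by (rule powr_bound_to_power_bound)
          (use pQ assms(4) that(1) l(2) t le(2) in \<open>auto simp: enn2real_ennpowr[OF ennpowr_finite[OF le(1)]]\<close>)
      \<comment> \<open>As Q \<ge> 1, the factor \<open>Q ^ k\<close> may be weakened to Q, which
        gives the same bound for every order.\<close>
      moreover have "Q * ((\<sigma>\<^sup>2 * p) ^ k * l\<^sup>2) \<le> Q ^ k * ((\<sigma>\<^sup>2 * p) ^ k * l\<^sup>2)"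
        using p that(1) self_le_power[OF Q, of k] by (intro mult_right_mono) auto
      ultimately have "Q * ((\<sigma>\<^sup>2 * p) ^ k * l\<^sup>2) \<le> t\<^sup>2"
        by (simp add: power_mult_distrib mult_ac)
      then show ?thesis using Q by (simp add: field_simps)
    qed
    have \<eta>k: "ennreal (p * Q) \<le> ennreal (t powr (2 / real k)) / (ennreal (\<sigma>\<^sup>2) * ennpowr (op_norm_Lp M 2 k f) (2 / real k))"
      if "1 \<le> k" "k < d" for k
      using \<eta> that unfolding eta_def by (auto simp: le_INF_iff)
    have \<eta>d: "ennreal (p * Q) \<le> ennreal (t powr (2 / real d)) / (ennreal (\<sigma>\<^sup>2) * ennpowr (op_norm_Lp M \<infinity> d f) (2 / real d))"
      using \<eta> unfolding eta_def by simp
    have k: "integrable M (\<lambda>x. (op_norm k f x)\<^sup>2)" "(\<sigma>\<^sup>2 * p) ^ k * (\<integral>x. (op_norm k f x)\<^sup>2 \<partial>M) \<le> t\<^sup>2 / Q"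
      if k: "1 \<le> k" "k < d" for k
    proof -
      obtain l where l: "k = Suc l" using k by (cases k) auto
      have "op_norm k f \<in> borel_measurable M"
        unfolding l by (rule measurable_op_norm[OF C_on_mono[OF assms(7)]]) (use k l in simp)
      moreover have "op_norm_Lp M 2 k f \<noteq> \<infinity>"
        by (rule ennpowr_finite[OF ennreal_le_quotientD(1)[OF \<eta>k[OF k] pQ assms(4) powr_ge_zero]])
      ultimately have L2: "integrable M (\<lambda>x. (op_norm k f x)\<^sup>2)"
        "(\<integral>x. (op_norm k f x)\<^sup>2 \<partial>M) = (enn2real (op_norm_Lp M 2 k f))\<^sup>2"
        unfolding l by (rule op_norm_L2[rotated])+
      show "integrable M (\<lambda>x. (op_norm k f x)\<^sup>2)" by (rule L2)
      show "(\<sigma>\<^sup>2 * p) ^ k * (\<integral>x. (op_norm k f x)\<^sup>2 \<partial>M) \<le> t\<^sup>2 / Q"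
        unfolding L2(2) by (rule power[OF k(1) \<eta>k[OF k] refl])
    qed
    define b where "b = enn2real (op_norm_Lp M \<infinity> d f)"
    have Linf: "op_norm_Lp M \<infinity> d f = ennreal b"
      using ennpowr_finite[OF ennreal_le_quotientD(1)[OF \<eta>d pQ assms(4) powr_ge_zero]]
      unfolding b_def by (simp add: less_top)
    have b0: "b \<ge> 0" by (simp add: b_def)
    have "esssup M (\<lambda>x. ennreal (op_norm d f x)) = ennreal b"
      using Linf by (simp add: op_norm_Lp_def)
    then have b: "AE x in M. op_norm d f x \<le> b"
      using esssup_AE[of "\<lambda>x. ennreal (op_norm d f x)" M] by (simp add: ennreal_le_iff[OF b0])
    show ?thesis
    proof (rule tail_bound[OF assms(7-9) p assms(6) t k b])
      show "(\<sigma>\<^sup>2 * p) ^ d * b\<^sup>2 \<le> t\<^sup>2 / Q" by (rule power[OF assms(6) \<eta>d b_def])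
      \<comment> \<open>With \<open>Q = (d e)^2\<close> the left-hand side is
        \<open>t^2 / (d e^2)\<close>.\<close>
      show "real d * (t\<^sup>2 / Q) \<le> (t / exp 1)\<^sup>2"
        using assms(6) mult_left_mono[of 1 "real d" "t * t"]
        by (simp add: Q_def power2_eq_square field_simps)
    qed (simp_all add: b_def)
  qed
  show ?thesis
  proof (cases "t = 0")
    case True
    then have "eta M \<sigma> d f t = 0" unfolding eta_def by simp
    then show ?thesis using order_trans[OF prob_le_1 e2] by (simp add: exp_neg_def)
  next
    case False
    with assms(10) have t: "t > 0" by simp
    show ?thesis
    proof (cases "eta M \<sigma> d f t")
      case (real y)
      have \<eta>: "eta M \<sigma> d f t / ennreal Q = ennreal (y / Q)"
        using real Q by (simp add: divide_ennreal)
      show ?thesis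
      proof (cases "y / Q \<ge> 2")
        case True
        have "?\<mu> \<le> exp (- (y / Q))"
          by (rule main[OF t True]) (use real Q in simp)
        also have "\<dots> \<le> (exp 1)\<^sup>2 * exp (- (y / Q))" using e2 by simp
        finally show ?thesis using real Q unfolding Q_def[symmetric] \<eta> by (simp add: exp_neg_def)
      next
        case False
        have "?\<mu> \<le> 1" by (rule prob_le_1)
        \<comment> \<open>Below p = 2 the prefactor \<open>e^2\<close> lifts the bound above 1, so
          it holds for any probability.\<close>
        also have "\<dots> \<le> exp (2 - y / Q)" using False by simp
        also have "\<dots> = (exp 1)\<^sup>2 * exp (- (y / Q))"
          by (simp add: power2_eq_square flip: exp_add)
        finally show ?thesis using real Q unfolding Q_def[symmetric] \<eta> by (simp add: exp_neg_def)
      qed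
    next
      case top
      \<comment> \<open>With an infinite \<open>eta\<close> every exponent p \<ge> 2 is admissible,
        so the event is null, in accordance with \<open>exp_neg \<infinity> = 0\<close>.\<close>
      have "(\<lambda>n. exp (- real n)) \<longlonglongrightarrow> 0"
        by (rule filterlim_compose[OF exp_at_bot])
          (simp add: filterlim_real_sequentially flip: filterlim_uminus_at_top)
      moreover have "?\<mu> \<le> exp (- real n)" if "n \<ge> 2" for n
        by (rule main[OF t]) (use that top in auto)
      ultimately have "?\<mu> \<le> 0" by (intro LIMSEQ_le_const) auto
      then show ?thesis by (rule order_trans) (simp add: exp_neg_def)
    qed
  qed
qed

end
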